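(* Let $m\in\mathbb{N}$ and $A\subseteq\mathbb{N}^m$. The following two statements are equivalent. (1) There exist functions $\alpha:\mathcal{P}_f(\mathbb{N}^{\mathbb{N}})\to\mathbb{N}$ and $H:\mathcal{P}_f(\mathbb{N}^{\mathbb{N}})\to\mathcal{P}_f(\mathbb{N})$ such that (a) if $F,G\in\mathcal{P}_f(\mathbb{N}^{\mathbb{N}})$ and $F\subsetneq G$, then $\max H(F)<\min H(G)$; and (b) whenever $n\in\mathbb{N}$ with $n\ge m$, $G_1\subsetneq G_2\subsetneq\cdots\subsetneq G_n$ in $\mathcal{P}_f(\mathbb{N}^{\mathbb{N}})$, $\beta_1<\beta_2<\cdots<\beta_m$ in $\mathcal{P}_f(\mathbb{N})$ with $\max\beta_m\le n$, and $f_i\in G_i$ for every $i\in\{1,\ldots,n\}$, one has $$\left(\sum_{i\in\beta_1}\Bigl(\alpha(G_i)+\sum_{t\in H(G_i)}f_i(t)\Bigr),\ldots,\sum_{i\in\beta_m}\Bigl(\alpha(G_i)+\sum_{t\in H(G_i)}f_i(t)\Bigr)\right)\in A.$$ (2) There exists an idempotent $p$ in $(\mathcal{J},+)$ such that $A\in\bigotimes_{i=1}^m p$.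
   Context: $\mathbb{N}$ is the set of positive integers; $\mathcal{P}_f(X)$ is the set of nonempty finite subsets of $X$; $\mathbb{N}^{\mathbb{N}}$ is the set of all functions $\mathbb{N}\to\mathbb{N}$. For $\beta,\gamma\in\mathcal{P}_f(\mathbb{N})$, $\beta<\gamma$ means $\max\beta<\min\gamma$. $\beta\mathbb{N}$ is the set of ultrafilters on $\mathbb{N}$, with the operation: $A\in p+q$ iff $\{x\in\mathbb{N}:-x+A\in q\}\in p$, where $-x+A=\{y\in\mathbb{N}:x+y\in A\}$. An ultrafilter $p$ is idempotent if $p+p=p$. A set $A\subseteq\mathbb{N}$ is a $J$-set if for every $F\in\mathcal{P}_f(\mathbb{N}^{\mathbb{N}})$ there exist $a\in\mathbb{N}$ and $\beta\in\mathcal{P}_f(\mathbb{N})$ such that $a+\sum_{t\in\beta}f(t)\in A$ for all $f\in F$. $\mathcal{J}=\{p\in\beta\mathbb{N}:\text{every }A\in p\text{ is a }J\text{-set}\}$; it is a two-sided ideal of $(\beta\mathbb{N},+)$. Tensor products: for ultrafilters $p_1,\ldots,p_k$ on $\mathbb{N}$, $\bigotimes_{i=1}^k p_i$ is the ultrafilter on $\mathbb{N}^k$ defined recursively by $\bigotimes_{i=1}^1p_i=p_1$, and, for $A\subseteq\mathbb{N}^{k+1}$, $A\in\bigotimes_{i=1}^{k+1}p_i$ iff $\{(x_1,\ldots,x_k)\in\mathbb{N}^k:\{x_{k+1}\in\mathbb{N}:(x_1,\ldots,x_{k+1})\in A\}\in p_{k+1}\}\in\bigotimes_{i=1}^kp_i$.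 $\bigotimes_{i=1}^mp$ is the case $p_i=p$ for all $i$. *)

theory Defs
  imports Complex_Main "HOL-Library.FuncSet"
begin

(* The positive integers are carried by a subset of nat, so that sums, Max and Min are the library's. *)
abbreviation posnat :: "nat set" where
  "posnat \<equiv> {1..}"

definition Pf :: "'a set \<Rightarrow> 'a set set" where
  "Pf X = {F. F \<subseteq> X \<and> finite F \<and> F \<noteq> {}}"

(* Extensional functions: two maps that agree on the positive integers are one element of this
   set, whatever they do at 0.  This matters for the strict inclusions between finite sets of maps. *)
abbreviation seqs :: "(nat \<Rightarrow> nat) set" where
  "seqs \<equiv> posnat \<rightarrow>\<^sub>E posnat"

definition block_less :: "nat set \<Rightarrow> nat set \<Rightarrow> bool" where
  "block_less B C \<longleftrightarrow> Max B < Min C"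

definition tuples :: "nat \<Rightarrow> nat list set" where
  "tuples k = {xs. length xs = k \<and> set xs \<subseteq> posnat}"

definition ultrafilter_on :: "'a set \<Rightarrow> 'a set set \<Rightarrow> bool" where
  "ultrafilter_on X p \<longleftrightarrow>
     p \<subseteq> Pow X \<and> X \<in> p \<and> {} \<notin> p \<and>
     (\<forall>A\<in>p. \<forall>B\<in>p. A \<inter> B \<in> p) \<and>
     (\<forall>A\<in>p. \<forall>B. A \<subseteq> B \<and> B \<subseteq> X \<longrightarrow> B \<in> p) \<and>
     (\<forall>A. A \<subseteq> X \<longrightarrow> A \<in> p \<or> X - A \<in> p)"

definition betaN :: "nat set set set" where
  "betaN = {p. ultrafilter_on posnat p}"

definition shift :: "nat \<Rightarrow> nat set \<Rightarrow> nat set" where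
  "shift x A = {y \<in> posnat. x + y \<in> A}"

definition uf_add :: "nat set set \<Rightarrow> nat set set \<Rightarrow> nat set set" where
  "uf_add p q = {A. A \<subseteq> posnat \<and> {x \<in> posnat. shift x A \<in> q} \<in> p}"

definition idempotent_uf :: "nat set set \<Rightarrow> bool" where
  "idempotent_uf p \<longleftrightarrow> uf_add p p = p"

definition J_set :: "nat set \<Rightarrow> bool" where
  "J_set A \<longleftrightarrow> A \<subseteq> posnat \<and>
     (\<forall>F \<in> Pf seqs. \<exists>a \<in> posnat. \<exists>B \<in> Pf posnat. \<forall>f\<in>F. a + (\<Sum>t\<in>B. f t) \<in> A)"

definition J_ufs :: "nat set set set" where
  "J_ufs = {p \<in> betaN. \<forall>A\<in>p. J_set A}"

(* tensor p k is the tensor product of p 1, ..., p k, a family of subsets of tuples k.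
   The mathematics starts at k = 1; the value at k = 0 is a convention. *)
fun tensor :: "(nat \<Rightarrow> nat set set) \<Rightarrow> nat \<Rightarrow> nat list set set" where
  "tensor p 0 = {tuples 0}"
| "tensor p (Suc 0) = {A. A \<subseteq> tuples 1 \<and> {x \<in> posnat. [x] \<in> A} \<in> p 1}"
| "tensor p (Suc (Suc k)) =
     {A. A \<subseteq> tuples (Suc (Suc k)) \<and>
         {xs \<in> tuples (Suc k). {x \<in> posnat. xs @ [x] \<in> A} \<in> p (Suc (Suc k))} \<in> tensor p (Suc k)}"

end

theory Submission
  imports Defs "HOL-Analysis.Abstract_Topological_Spaces"
begin

text \<open>Membership of \<open>A\<close> in the tensor power of \<open>p\<close> is an iterated ``for \<open>p\<close>-many'' quantifier.
  Given an idempotent \<open>p\<close> whose members are J-sets, \<open>\<alpha> F\<close> and \<open>H F\<close> are chosen by recursion on the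
  finite set \<open>F\<close>: only finitely many tuples of block sums arise from chains below \<open>F\<close>, and each of
  them restricts the next summand to a member of \<open>p\<close>, by the standard fact that \<open>x \<in> star p A\<close> implies
  \<open>shift x (star p A) \<in> p\<close>.

  Conversely, let \<open>sums_above F\<close> be the set of sums along chains strictly above \<open>F\<close>. The ultrafilters
  containing every \<open>sums_above F\<close> form a compact subsemigroup \<open>Q\<close>, and every \<open>p\<close> in \<open>Q\<close> satisfies the iterated
  quantifier. To get J-sets, take \<open>p\<close> to be a minimal idempotent of \<open>Q\<close> and consider vectors of
  sums, indexed by all functions \<open>f\<close>, in which at least one link of the chain contributes
  \<open>\<alpha> G + (\<Sum>t\<in>H G. f t)\<close> to coordinate \<open>f\<close>. The corresponding ultrafilters on vectors form a
  compact semigroup \<open>I\<close> absorbing the diagonal image of \<open>p\<close>, so \<open>I\<close> has an idempotent \<open>e\<close> below that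
  image. All projections of \<open>e\<close> lie in \<open>Q\<close> below \<open>p\<close>, hence equal \<open>p\<close>, and the vectors in
  the members of \<open>e\<close> witness the J-set property. No partition regularity of J-sets is needed.\<close>

section \<open>Compact right topological semigroups\<close>

locale compact_right_topological_semigroup =
  fixes X :: "'a topology" and mult :: "'a \<Rightarrow> 'a \<Rightarrow> 'a" (infixl "\<odot>" 70)
  assumes compact: "compact_space X" and Hausdorff: "Hausdorff_space X"
    and closed: "\<lbrakk>x \<in> topspace X; y \<in> topspace X\<rbrakk> \<Longrightarrow> x \<odot> y \<in> topspace X"
    and assoc: "\<lbrakk>x \<in> topspace X; y \<in> topspace X; z \<in> topspace X\<rbrakk> \<Longrightarrow> x \<odot> y \<odot> z = x \<odot> (y \<odot> z)"
    and continuous: "y \<in> topspace X \<Longrightarrow> continuous_map X X (\<lambda>x. x \<odot> y)"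
begin

definition closed_subsemigroup :: "'a set \<Rightarrow> bool" where
  "closed_subsemigroup C \<longleftrightarrow> closedin X C \<and> C \<noteq> {} \<and> (\<forall>x\<in>C. \<forall>y\<in>C. x \<odot> y \<in> C)"

definition closed_left_ideal :: "'a set \<Rightarrow> 'a set \<Rightarrow> bool" where
  "closed_left_ideal C L \<longleftrightarrow> closedin X L \<and> L \<noteq> {} \<and> L \<subseteq> C \<and> (\<forall>x\<in>C. \<forall>y\<in>L. x \<odot> y \<in> L)"

text \<open>Closed sets are compact here, and continuous images of compact sets are closed in a
  Hausdorff space. Only the left factor varies continuously, so the arguments below use sets of the
  form C y.\<close>

lemma closedin_right_translate:
  assumes "closedin X C" "y \<in> topspace X"
  shows "closedin X ((\<lambda>x. x \<odot> y) ` C)"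
  using assms Hausdorff closedin_compact_space[OF compact]
  by (intro compactin_imp_closedin image_compactin[OF _ continuous])

text \<open>A nonempty finite subfamily of a chain has its smallest member as intersection, so
  compactness in its finite-intersection form applies.\<close>

lemma Inter_chain_nonempty:
  assumes "\<C> \<noteq> {}" and "\<And>C. C \<in> \<C> \<Longrightarrow> closedin X C \<and> C \<noteq> {}"
    and chain: "\<And>C D. \<lbrakk>C \<in> \<C>; D \<in> \<C>\<rbrakk> \<Longrightarrow> C \<subseteq> D \<or> D \<subseteq> C"
  shows "\<Inter>\<C> \<noteq> {}"
proof -
  have "\<F> \<noteq> {} \<longrightarrow> \<Inter>\<F> \<in> \<C>" if "finite \<F>" "\<F> \<subseteq> \<C>" for \<F>
    using that
  proof (induction \<F>)
    case (insert C \<F>)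
    show ?case
    proof (cases "\<F> = {}")
      case False
      then have "\<Inter>\<F> \<in> \<C>" "C \<in> \<C>" using insert by auto
      then have "C \<inter> \<Inter>\<F> = C \<or> C \<inter> \<Inter>\<F> = \<Inter>\<F>" using chain by blast
      with \<open>\<Inter>\<F> \<in> \<C>\<close> \<open>C \<in> \<C>\<close> show ?thesis by (metis Inter_insert)
    qed (use insert in simp)
  qed simp
  then have "\<forall>\<F>. finite \<F> \<and> \<F> \<subseteq> \<C> \<longrightarrow> \<Inter>\<F> \<noteq> {}"
    using assms(2) by (intro allI impI; case_tac "\<F> = {}") auto
  then show ?thesis
    using compact assms(2) unfolding compact_space_fip by blast
qed

text \<open>Zorn's lemma for reverse inclusion. The predicate \<open>P\<close> lets one argument
  serve closed subsemigroups and closed left ideals; compactness supplies closedness and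
  nonemptiness of intersections, so an application checks only the algebraic part of
  \<open>Inter\<close>.\<close>

lemma minimal_closed_subset:
  assumes "P C" and closed: "\<And>C. P C \<Longrightarrow> closedin X C \<and> C \<noteq> {}"
    and Inter: "\<And>\<C>. \<lbrakk>\<C> \<noteq> {}; \<And>C. C \<in> \<C> \<Longrightarrow> P C; closedin X (\<Inter>\<C>); \<Inter>\<C> \<noteq> {}\<rbrakk> \<Longrightarrow> P (\<Inter>\<C>)"
  obtains M where "P M" "M \<subseteq> C" "\<And>D. \<lbrakk>P D; D \<subseteq> M\<rbrakk> \<Longrightarrow> D = M"
proof -
  let ?A = "{D. P D \<and> D \<subseteq> C}"
  have "\<exists>M\<in>?A. \<forall>D\<in>?A. M \<supseteq> D \<longrightarrow> D = M"
  proof (rule predicate_Zorn)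
    show "partial_order_on ?A (relation_of (\<supseteq>) ?A)"
      by (rule partial_order_on_relation_ofI) auto
  next
    fix \<C> assume \<C>: "\<C> \<in> Chains (relation_of (\<supseteq>) ?A)"
    show "\<exists>U\<in>?A. \<forall>D\<in>\<C>. D \<supseteq> U"
    proof (cases "\<C> = {}")
      case True
      then show ?thesis using \<open>P C\<close> by auto
    next
      case False
      have chain: "D \<subseteq> E \<or> E \<subseteq> D" if "D \<in> \<C>" "E \<in> \<C>" for D E
        using \<C> that by (auto simp: Chains_def relation_of_def)
      have sub: "P D \<and> D \<subseteq> C" if "D \<in> \<C>" for D
        using \<C> that by (auto simp: Chains_def relation_of_def)
      have "\<Inter>\<C> \<noteq> {}"
        using False sub closed chain by (intro Inter_chain_nonempty) blast+
      moreover have "closedin X (\<Inter>\<C>)"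
        using False sub closed by (intro closedin_Inter) auto
      ultimately have "P (\<Inter>\<C>)"
        using Inter False sub by blast
      then show ?thesis using False sub by blast
    qed
  qed
  then obtain M where M: "P M" "M \<subseteq> C" and max: "\<forall>D\<in>?A. D \<subseteq> M \<longrightarrow> D = M" by auto
  show thesis
  proof (rule that)
    show "D = M" if "P D" "D \<subseteq> M" for D using that max \<open>M \<subseteq> C\<close> by auto
  qed fact+
qed

text \<open>A minimal closed subsemigroup \<open>M\<close> is examined at an arbitrary point
  \<open>p\<close>: minimality forces first M p = M and then x p = p for every x in
  \<open>M\<close>, in particular for p itself.\<close>

theorem Ellis_idempotent:
  assumes "closed_subsemigroup C"
  obtains p where "p \<in> C" "p \<odot> p = p"
proof -
  obtain M where M: "closed_subsemigroup M" "M \<subseteq> C"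
    and min: "\<And>D. \<lbrakk>closed_subsemigroup D; D \<subseteq> M\<rbrakk> \<Longrightarrow> D = M"
  proof (rule minimal_closed_subset[of closed_subsemigroup, OF assms])
    show "closed_subsemigroup (\<Inter>\<C>)"
      if "\<And>C. C \<in> \<C> \<Longrightarrow> closed_subsemigroup C" "closedin X (\<Inter>\<C>)" "\<Inter>\<C> \<noteq> {}" for \<C>
      using that unfolding closed_subsemigroup_def by simp
  qed (auto simp: closed_subsemigroup_def)
  then have Mc: "closedin X M" and Mm: "\<And>x y. \<lbrakk>x \<in> M; y \<in> M\<rbrakk> \<Longrightarrow> x \<odot> y \<in> M"
    by (auto simp: closed_subsemigroup_def)
  from Mc have Mt: "\<And>x. x \<in> M \<Longrightarrow> x \<in> topspace X" using closedin_subset by blast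
  obtain p where p: "p \<in> M" using M(1) by (auto simp: closed_subsemigroup_def)
  have "closed_subsemigroup ((\<lambda>x. x \<odot> p) ` M)"
    unfolding closed_subsemigroup_def
  proof (intro conjI ballI)
    show "closedin X ((\<lambda>x. x \<odot> p) ` M)" by (simp add: closedin_right_translate Mc Mt p)
    fix x y assume "x \<in> (\<lambda>x. x \<odot> p) ` M" "y \<in> (\<lambda>x. x \<odot> p) ` M"
    then obtain a b where ab: "a \<in> M" "b \<in> M" and xy: "x = a \<odot> p" "y = b \<odot> p" by auto
    have "x \<odot> y = (a \<odot> p \<odot> b) \<odot> p" unfolding xy using ab p by (simp add: assoc Mt Mm)
    moreover have "a \<odot> p \<odot> b \<in> M" using ab p by (simp add: Mm)
    ultimately show "x \<odot> y \<in> (\<lambda>x. x \<odot> p) ` M" by blast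
  qed (use p in auto)
  \<comment> \<open>M p is a closed subsemigroup inside \<open>M\<close>. The resulting equality
    gives some x in \<open>M\<close> with x p = p, which makes \<open>?N\<close> nonempty.\<close>
  then have Mp: "(\<lambda>x. x \<odot> p) ` M = M" using min p Mm by blast
  let ?N = "{x \<in> M. x \<odot> p = p}"
  have "closed_subsemigroup ?N"
    unfolding closed_subsemigroup_def
  proof (intro conjI)
    have "closedin X {x \<in> M. x \<odot> p \<in> {p}}"
      using Mc Mt p closedin_Hausdorff_singleton[OF Hausdorff]
      by (intro closedin_continuous_map_preimage_gen[OF continuous]) auto
    then show "closedin X ?N" by simp
    have "p \<in> (\<lambda>x. x \<odot> p) ` M" using Mp p by simp
    then show "?N \<noteq> {}" by auto
    show "\<forall>x\<in>?N. \<forall>y\<in>?N. x \<odot> y \<in> ?N" using p by (auto simp: assoc Mt Mm)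
  qed
  then have "?N = M" using min by blast
  then have "p \<odot> p = p" using p by blast
  then show thesis using that p M(2) by blast
qed

text \<open>Any idempotent of a minimal closed left ideal \<open>L\<close> is minimal for the order
  in which e \<le> p means e p = p e = e.\<close>

theorem minimal_idempotent:
  assumes "closed_subsemigroup C"
  obtains p where "p \<in> C" "p \<odot> p = p"
    "\<forall>e\<in>C. e \<odot> e = e \<and> e \<odot> p = e \<and> p \<odot> e = e \<longrightarrow> e = p"
proof -
  have C: "closedin X C" "C \<noteq> {}" and Cm: "\<And>x y. \<lbrakk>x \<in> C; y \<in> C\<rbrakk> \<Longrightarrow> x \<odot> y \<in> C"
    using assms by (auto simp: closed_subsemigroup_def)
  then have Ct: "\<And>x. x \<in> C \<Longrightarrow> x \<in> topspace X" using closedin_subset by blast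
  have "closed_left_ideal C C" using C Cm by (auto simp: closed_left_ideal_def)
  then obtain L where L: "closed_left_ideal C L"
    and min: "\<And>D. \<lbrakk>closed_left_ideal C D; D \<subseteq> L\<rbrakk> \<Longrightarrow> D = L"
  proof (rule minimal_closed_subset[of "closed_left_ideal C"])
    show "closed_left_ideal C (\<Inter>\<C>)"
      if "\<C> \<noteq> {}" "\<And>D. D \<in> \<C> \<Longrightarrow> closed_left_ideal C D" "closedin X (\<Inter>\<C>)" "\<Inter>\<C> \<noteq> {}" for \<C>
      using that unfolding closed_left_ideal_def by (auto simp: Inf_less_eq)
  qed (auto simp: closed_left_ideal_def)
  then have LC: "L \<subseteq> C" and Lm: "\<And>x y. \<lbrakk>x \<in> C; y \<in> L\<rbrakk> \<Longrightarrow> x \<odot> y \<in> L"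
    by (auto simp: closed_left_ideal_def)
  have "closed_subsemigroup L"
    using L by (auto simp: closed_subsemigroup_def closed_left_ideal_def)
  then obtain p where p: "p \<in> L" "p \<odot> p = p" using Ellis_idempotent by blast
  show thesis
  proof (rule that; (intro ballI impI; elim conjE)?)
    show "p \<in> C" "p \<odot> p = p" using p LC by auto
    fix e assume e: "e \<in> C" "e \<odot> e = e" "e \<odot> p = e" "p \<odot> e = e"
    then have "e \<in> L" using Lm p by metis
    have "closed_left_ideal C ((\<lambda>x. x \<odot> e) ` C)"
      unfolding closed_left_ideal_def
    proof (intro conjI ballI)
      fix x y assume "x \<in> C" "y \<in> (\<lambda>x. x \<odot> e) ` C"
      then show "x \<odot> y \<in> (\<lambda>x. x \<odot> e) ` C" using e(1) by (auto simp: Ct Cm assoc[symmetric])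
    qed (use C e(1) in \<open>auto simp: closedin_right_translate Ct Cm\<close>)
    moreover have "(\<lambda>x. x \<odot> e) ` C \<subseteq> L" using Lm \<open>e \<in> L\<close> by blast
    \<comment> \<open>C e is a closed left ideal inside \<open>L\<close>, hence equals
      \<open>L\<close>, and p = x e. Right multiplication by e then gives p e = p, whereas p e = e
      by assumption.\<close>
    ultimately have "p \<in> (\<lambda>x. x \<odot> e) ` C" using min p by blast
    then obtain x where x: "x \<in> C" "p = x \<odot> e" by blast
    have "e = x \<odot> e \<odot> e" using e x by simp
    also have "\<dots> = x \<odot> e" using x e by (simp add: Ct assoc)
    finally show "e = p" using x by simp
  qed
qed

text \<open>The point \<open>p\<close> may lie outside \<open>I\<close>. An idempotent d of the
  closed subsemigroup I p satisfies d p = d, and p d is then idempotent because d p d = d, and is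
  fixed by p on both sides.\<close>

theorem idempotent_below:
  assumes I: "closed_subsemigroup I" and p: "p \<in> topspace X" "p \<odot> p = p"
    and Ip: "\<And>x. x \<in> I \<Longrightarrow> x \<odot> p \<in> I" and pI: "\<And>x. x \<in> I \<Longrightarrow> p \<odot> x \<in> I"
  obtains e where "e \<in> I" "e \<odot> e = e" "e \<odot> p = e" "p \<odot> e = e"
proof -
  have Ic: "closedin X I" and Im: "\<And>x y. \<lbrakk>x \<in> I; y \<in> I\<rbrakk> \<Longrightarrow> x \<odot> y \<in> I"
    using I by (auto simp: closed_subsemigroup_def)
  from Ic have It: "\<And>x. x \<in> I \<Longrightarrow> x \<in> topspace X" using closedin_subset by blast
  have "closed_subsemigroup ((\<lambda>x. x \<odot> p) ` I)"
    unfolding closed_subsemigroup_def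
  proof (intro conjI ballI)
    fix x y assume "x \<in> (\<lambda>x. x \<odot> p) ` I" "y \<in> (\<lambda>x. x \<odot> p) ` I"
    then obtain a b where ab: "a \<in> I" "b \<in> I" and xy: "x = a \<odot> p" "y = b \<odot> p" by auto
    have "x \<odot> y = (a \<odot> p \<odot> b) \<odot> p" unfolding xy using ab p(1) by (simp add: assoc It closed)
    moreover have "a \<odot> p \<odot> b \<in> I" using ab by (simp add: Im Ip)
    ultimately show "x \<odot> y \<in> (\<lambda>x. x \<odot> p) ` I" by blast
  qed (use I in \<open>auto simp: closed_subsemigroup_def closedin_right_translate p\<close>)
  then obtain d where d: "d \<in> (\<lambda>x. x \<odot> p) ` I" "d \<odot> d = d" using Ellis_idempotent by blast
  then obtain x where x: "x \<in> I" "d = x \<odot> p" by blast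
  have dI: "d \<in> I" using x Ip by simp
  have dp: "d \<odot> p = d" using x p by (simp add: assoc It)
  show thesis
  proof (rule that[of "p \<odot> d"])
    show "p \<odot> d \<in> I" by (simp add: pI dI)
    have "p \<odot> d \<odot> (p \<odot> d) = p \<odot> (d \<odot> p \<odot> d)" using dI p(1) by (simp add: assoc It closed)
    then show "p \<odot> d \<odot> (p \<odot> d) = p \<odot> d" by (simp add: dp d(2))
    show "p \<odot> d \<odot> p = p \<odot> d" using dI p(1) by (simp add: assoc It dp)
    show "p \<odot> (p \<odot> d) = p \<odot> d" using dI p by (simp add: assoc[symmetric] It)
  qed
qed

end

section \<open>The semigroup of ultrafilters\<close>

lemma ultrafilter_onD:
  assumes "ultrafilter_on X p"
  shows "A \<in> p \<Longrightarrow> A \<subseteq> X" "X \<in> p" "{} \<notin> p" "\<lbrakk>A \<in> p; B \<in> p\<rbrakk> \<Longrightarrow> A \<inter> B \<in> p"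
    "\<lbrakk>A \<in> p; A \<subseteq> B; B \<subseteq> X\<rbrakk> \<Longrightarrow> B \<in> p"
    "A \<subseteq> X \<Longrightarrow> X - A \<in> p \<longleftrightarrow> A \<notin> p"
proof -
  show "A \<subseteq> X \<Longrightarrow> X - A \<in> p \<longleftrightarrow> A \<notin> p"
    using assms unfolding ultrafilter_on_def by (metis Diff_disjoint)
qed (use assms in \<open>auto simp: ultrafilter_on_def\<close>)

lemma ultrafilter_on_Int_iff:
  assumes "ultrafilter_on X p" "A \<subseteq> X" "B \<subseteq> X"
  shows "A \<inter> B \<in> p \<longleftrightarrow> A \<in> p \<and> B \<in> p"
  using ultrafilter_onD(4,5)[OF assms(1)] assms(2,3) by (metis inf_le1 inf_le2)

text \<open>The comprehension over \<open>X\<close> replaces an intersection so that an empty index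
  set yields \<open>X\<close>.\<close>

lemma ultrafilter_on_Inter:
  assumes "ultrafilter_on X p" "finite I" "\<And>i. i \<in> I \<Longrightarrow> A i \<in> p"
  shows "{x \<in> X. \<forall>i\<in>I. x \<in> A i} \<in> p"
  using assms(2,3)
proof (induction I)
  case (insert i I)
  have "{x \<in> X. \<forall>j\<in>insert i I. x \<in> A j} = A i \<inter> {x \<in> X. \<forall>j\<in>I. x \<in> A j}"
    using ultrafilter_onD(1)[OF assms(1)] insert.prems by auto
  then show ?case using insert ultrafilter_onD(4)[OF assms(1)] by simp
qed (use ultrafilter_onD(2)[OF assms(1)] in simp)

text \<open>A set A in \<open>q\<close> outside \<open>p\<close> would put \<open>X - A\<close> into
  \<open>p\<close>, hence into \<open>q\<close> beside A.\<close>

lemma ultrafilter_on_eqI: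
  assumes "ultrafilter_on X p" "ultrafilter_on X q" "p \<subseteq> q"
  shows "p = q"
  using assms ultrafilter_onD(1,6) by (metis subsetD subsetI subset_antisym)

text \<open>Zorn's lemma yields a maximal family extending \<B> with the finite intersection
  property relative to \<open>X\<close>; the factor \<open>X\<close> covers the empty
  subfamily.\<close>

theorem ultrafilter_on_exists:
  assumes "\<B> \<subseteq> Pow X" and fip: "\<And>\<F>. \<lbrakk>finite \<F>; \<F> \<subseteq> \<B>\<rbrakk> \<Longrightarrow> X \<inter> \<Inter>\<F> \<noteq> {}"
  obtains p where "ultrafilter_on X p" "\<B> \<subseteq> p"
proof -
  let ?fip = "\<lambda>\<M>. \<forall>\<F>. finite \<F> \<and> \<F> \<subseteq> \<M> \<longrightarrow> X \<inter> \<Inter>\<F> \<noteq> {}"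
  let ?Z = "{\<M>. \<B> \<subseteq> \<M> \<and> \<M> \<subseteq> Pow X \<and> ?fip \<M>}"
  have "\<exists>\<M>\<in>?Z. \<forall>\<N>\<in>?Z. \<M> \<subseteq> \<N> \<longrightarrow> \<N> = \<M>"
  proof (rule subset_Zorn_nonempty)
    have "\<B> \<in> ?Z" using assms by simp
    then show "?Z \<noteq> {}" by blast
    fix \<C> assume \<C>: "\<C> \<noteq> {}" "subset.chain ?Z \<C>"
    have sub: "\<B> \<subseteq> \<N> \<and> \<N> \<subseteq> Pow X \<and> ?fip \<N>" if "\<N> \<in> \<C>" for \<N>
      using \<C>(2) that by (auto simp: subset.chain_def)
    have "X \<inter> \<Inter>\<F> \<noteq> {}" if \<F>: "finite \<F>" "\<F> \<subseteq> \<Union>\<C>" for \<F>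
    proof -
      obtain \<N> where "\<N> \<in> \<C>" "\<F> \<subseteq> \<N>"
        using finite_subset_Union_chain[OF \<F> \<C>] by blast
      then show ?thesis using sub[of \<N>] \<F>(1) by simp
    qed
    moreover have "\<B> \<subseteq> \<Union>\<C>" "\<Union>\<C> \<subseteq> Pow X" using sub \<C>(1) by blast+
    ultimately show "\<Union>\<C> \<in> ?Z" by simp
  qed
  then obtain \<M> where MZ: "\<M> \<in> ?Z" and maxZ: "\<forall>\<N>\<in>?Z. \<M> \<subseteq> \<N> \<longrightarrow> \<N> = \<M>"
    by (rule bexE)
  have \<M>: "\<B> \<subseteq> \<M>" "\<M> \<subseteq> Pow X" "?fip \<M>" using MZ by simp_all
  have max: "\<N> = \<M>" if "\<B> \<subseteq> \<N>" "\<N> \<subseteq> Pow X" "?fip \<N>" "\<M> \<subseteq> \<N>" for \<N>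
    using maxZ that by simp
  \<comment> \<open>Maximality in usable form: a set that meets every finite intersection can be
    adjoined, hence is already present. The membership claims below reduce to this.\<close>
  have mem: "A \<in> \<M>" if "A \<subseteq> X" and meet: "\<And>\<F>. \<lbrakk>finite \<F>; \<F> \<subseteq> \<M>\<rbrakk> \<Longrightarrow> X \<inter> \<Inter>\<F> \<inter> A \<noteq> {}" for A
  proof -
    have "?fip (insert A \<M>)"
    proof (intro allI impI)
      fix \<F> assume \<F>: "finite \<F> \<and> \<F> \<subseteq> insert A \<M>"
      then have "X \<inter> \<Inter>(\<F> - {A}) \<inter> A \<noteq> {}" by (intro meet) auto
      then show "X \<inter> \<Inter>\<F> \<noteq> {}" by blast
    qed
    then have "insert A \<M> = \<M>" using \<M> \<open>A \<subseteq> X\<close> by (intro max) auto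
    then show ?thesis by blast
  qed
  have Int: "X \<inter> \<Inter>\<F> \<noteq> {}" if "finite \<F>" "\<F> \<subseteq> \<M>" for \<F> using \<M>(3) that by blast
  have "ultrafilter_on X \<M>"
    unfolding ultrafilter_on_def
  proof (intro conjI ballI allI impI)
    show "\<M> \<subseteq> Pow X" by fact
    show "X \<in> \<M>" using Int by (intro mem) auto
    show "{} \<notin> \<M>" using Int[of "{{}}"] by auto
  next
    fix A B assume AB: "A \<in> \<M>" "B \<in> \<M>"
    show "A \<inter> B \<in> \<M>"
    proof (rule mem)
      show "A \<inter> B \<subseteq> X" using AB \<M>(2) by blast
      fix \<F> assume "finite \<F>" "\<F> \<subseteq> \<M>"
      then have "X \<inter> \<Inter>(insert A (insert B \<F>)) \<noteq> {}" using AB by (intro Int) auto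
      then show "X \<inter> \<Inter>\<F> \<inter> (A \<inter> B) \<noteq> {}" by auto
    qed
  next
    fix A B assume A: "A \<in> \<M>" and B: "A \<subseteq> B \<and> B \<subseteq> X"
    show "B \<in> \<M>"
    proof (rule mem)
      fix \<F> assume "finite \<F>" "\<F> \<subseteq> \<M>"
      then have "X \<inter> \<Inter>(insert A \<F>) \<noteq> {}" using A by (intro Int) auto
      then show "X \<inter> \<Inter>\<F> \<inter> B \<noteq> {}" using B by auto
    qed (use B in simp)
  next
    fix A assume "A \<subseteq> X"
    show "A \<in> \<M> \<or> X - A \<in> \<M>"
    proof (rule ccontr)
      assume no: "\<not> ?thesis"
      \<comment> \<open>One finite subfamily would miss A and another its complement, so their union
        would have empty intersection.\<close>
      have "\<exists>\<F>. finite \<F> \<and> \<F> \<subseteq> \<M> \<and> X \<inter> \<Inter>\<F> \<inter> B = {}" if "B \<notin> \<M>" "B \<subseteq> X" for B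
        using mem[of B] that by metis
      then obtain \<F> \<G> where "finite \<F>" "\<F> \<subseteq> \<M>" and \<F>: "X \<inter> \<Inter>\<F> \<inter> A = {}"
        and "finite \<G>" "\<G> \<subseteq> \<M>" and \<G>: "X \<inter> \<Inter>\<G> \<inter> (X - A) = {}"
        using no \<open>A \<subseteq> X\<close> by (metis Diff_subset)
      then have "X \<inter> \<Inter>(\<F> \<union> \<G>) \<noteq> {}" by (intro Int) auto
      then obtain x where "x \<in> X" "x \<in> \<Inter>\<F>" "x \<in> \<Inter>\<G>" by auto
      then show False using \<F> \<G> by blast
    qed
  qed
  then show thesis using that \<M>(1) by blast
qed

text \<open>In a directed family every finite intersection contains a single nonempty member, which
  gives the finite intersection property.\<close>

lemma ultrafilter_on_exists_directed:
  assumes "I \<noteq> {}" and B: "\<And>i. i \<in> I \<Longrightarrow> B i \<subseteq> X \<and> B i \<noteq> {}"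
    and dir: "\<And>i j. \<lbrakk>i \<in> I; j \<in> I\<rbrakk> \<Longrightarrow> \<exists>k\<in>I. B k \<subseteq> B i \<inter> B j"
  obtains p where "ultrafilter_on X p" "\<forall>i\<in>I. B i \<in> p"
proof (rule ultrafilter_on_exists[of "B ` I" X])
  show "B ` I \<subseteq> Pow X" using B by blast
  fix \<F> assume "finite \<F>" "\<F> \<subseteq> B ` I"
  then have "\<exists>k\<in>I. B k \<subseteq> \<Inter>\<F>"
  proof (induction \<F>)
    case (insert A \<F>)
    then obtain k i where "k \<in> I" "B k \<subseteq> \<Inter>\<F>" "i \<in> I" "A = B i" by auto
    then show ?case using dir[of i k] by blast
  qed (use assms(1) in auto)
  then show "X \<inter> \<Inter>\<F> \<noteq> {}" using B by fast
qed blast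

section \<open>The Stone topology on the ultrafilters of a set\<close>

definition stone_topology :: "'a set \<Rightarrow> 'a set set topology" where
  "stone_topology X = topology (\<lambda>Z. Z \<subseteq> {p. ultrafilter_on X p} \<and>
     (\<forall>p\<in>Z. \<exists>A\<in>p. \<forall>q. ultrafilter_on X q \<and> A \<in> q \<longrightarrow> q \<in> Z))"

text \<open>The defining condition asks for a basic neighbourhood of each point. Two such
  neighbourhoods intersect in a third, because an ultrafilter contains \<open>A \<inter> B\<close>
  exactly when it contains both A and B.\<close>

lemma openin_stone_topology:
  "openin (stone_topology X) Z \<longleftrightarrow> Z \<subseteq> {p. ultrafilter_on X p} \<and>
     (\<forall>p\<in>Z. \<exists>A\<in>p. \<forall>q. ultrafilter_on X q \<and> A \<in> q \<longrightarrow> q \<in> Z)"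
proof -
  have "istopology (\<lambda>Z. Z \<subseteq> {p. ultrafilter_on X p} \<and>
     (\<forall>p\<in>Z. \<exists>A\<in>p. \<forall>q. ultrafilter_on X q \<and> A \<in> q \<longrightarrow> q \<in> Z))"
    unfolding istopology_def
  proof (intro conjI allI impI ballI; (elim conjE)?)
    fix S T p
    assume S: "S \<subseteq> {p. ultrafilter_on X p}" "\<forall>p\<in>S. \<exists>A\<in>p. \<forall>q. ultrafilter_on X q \<and> A \<in> q \<longrightarrow> q \<in> S"
      and T: "\<forall>p\<in>T. \<exists>A\<in>p. \<forall>q. ultrafilter_on X q \<and> A \<in> q \<longrightarrow> q \<in> T"
      and "p \<in> S \<inter> T"
    then have p: "p \<in> S" "p \<in> T" and up: "ultrafilter_on X p" by auto
    from S(2) T p obtain A B where "A \<in> p" "B \<in> p"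
      and "\<forall>q. ultrafilter_on X q \<and> A \<in> q \<longrightarrow> q \<in> S" "\<forall>q. ultrafilter_on X q \<and> B \<in> q \<longrightarrow> q \<in> T"
      by metis
    moreover from this have "A \<inter> B \<in> p" using ultrafilter_onD(4)[OF up] by blast
    ultimately show "\<exists>A\<in>p. \<forall>q. ultrafilter_on X q \<and> A \<in> q \<longrightarrow> q \<in> S \<inter> T"
      using ultrafilter_on_Int_iff ultrafilter_onD(1)[OF up] by (metis IntI)
  next
    fix \<K> p
    assume \<K>: "\<forall>K\<in>\<K>. K \<subseteq> {p. ultrafilter_on X p} \<and> (\<forall>p\<in>K. \<exists>A\<in>p. \<forall>q. ultrafilter_on X q \<and> A \<in> q \<longrightarrow> q \<in> K)"
      and "p \<in> \<Union>\<K>"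
    then obtain K where K: "K \<in> \<K>" "p \<in> K" by blast
    with \<K> obtain A where "A \<in> p" "\<forall>q. ultrafilter_on X q \<and> A \<in> q \<longrightarrow> q \<in> K" by metis
    with K show "\<exists>A\<in>p. \<forall>q. ultrafilter_on X q \<and> A \<in> q \<longrightarrow> q \<in> \<Union>\<K>" by blast
  qed auto
  then show ?thesis unfolding stone_topology_def by (simp add: topology_inverse')
qed

lemma openin_stone_basis:
  "openin (stone_topology X) {p. ultrafilter_on X p \<and> A \<in> p}"
  by (auto simp: openin_stone_topology)

lemma topspace_stone_topology [simp]: "topspace (stone_topology X) = {p. ultrafilter_on X p}"
proof -
  have "openin (stone_topology X) {p. ultrafilter_on X p}"
    unfolding openin_stone_topology using ultrafilter_onD(2) by blast
  then show ?thesis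
    using openin_subset openin_topspace openin_stone_topology by (metis subset_antisym)
qed

text \<open>An ultrafilter omits \<open>B i\<close> iff it contains the complement, so the
  complement of this set is a union of basic open sets. The sets \<open>Q\<close> and
  \<open>I\<close> below are closed for this reason.\<close>

lemma closedin_stone_basis:
  assumes "\<And>i. i \<in> I \<Longrightarrow> B i \<subseteq> X"
  shows "closedin (stone_topology X) {p. ultrafilter_on X p \<and> (\<forall>i\<in>I. B i \<in> p)}"
proof -
  have "topspace (stone_topology X) - {p. ultrafilter_on X p \<and> (\<forall>i\<in>I. B i \<in> p)}
      = (\<Union>i\<in>I. {p. ultrafilter_on X p \<and> X - B i \<in> p})"
  proof -
    have "X - B i \<in> p \<longleftrightarrow> B i \<notin> p" if "ultrafilter_on X p" "i \<in> I" for p i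
      using ultrafilter_onD(6)[OF that(1) assms[OF that(2)]] .
    then show ?thesis by auto
  qed
  then show ?thesis unfolding closedin_def by (auto intro: openin_stone_basis)
qed

text \<open>Without a finite subcover, the complements of those A whose basic open set lies inside a
  member of the cover have the finite intersection property. An ultrafilter containing them all lies
  in no member of the cover.\<close>

lemma compact_space_stone_topology: "compact_space (stone_topology X)"
  unfolding compact_space_alt
proof (intro allI impI; elim conjE)
  fix \<U> assume op: "\<forall>U\<in>\<U>. openin (stone_topology X) U"
    and cov: "topspace (stone_topology X) \<subseteq> \<Union>\<U>"
  let ?S = "\<lambda>A. {q. ultrafilter_on X q \<and> A \<in> q}"
  let ?B = "{X - A | A. A \<subseteq> X \<and> (\<exists>U\<in>\<U>. ?S A \<subseteq> U)}"
  show "\<exists>\<F>. finite \<F> \<and> \<F> \<subseteq> \<U> \<and> topspace (stone_topology X) \<subseteq> \<Union>\<F>"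
  proof (rule ccontr)
    assume no: "\<nexists>\<F>. finite \<F> \<and> \<F> \<subseteq> \<U> \<and> topspace (stone_topology X) \<subseteq> \<Union>\<F>"
    obtain p where p: "ultrafilter_on X p" "?B \<subseteq> p"
    proof (rule ultrafilter_on_exists[of ?B X])
      fix \<F> assume "finite \<F>" "\<F> \<subseteq> ?B"
      \<comment> \<open>Finitely many complements involve finitely many members \<G> of the cover,
        and an ultrafilter outside their union contains all these complements.\<close>
      then have "\<exists>\<G>. finite \<G> \<and> \<G> \<subseteq> \<U> \<and> (\<forall>q. ultrafilter_on X q \<longrightarrow> q \<notin> \<Union>\<G> \<longrightarrow> \<F> \<subseteq> q)"
      proof (induction \<F>)
        case (insert C \<F>)
        then have "\<exists>\<G>. finite \<G> \<and> \<G> \<subseteq> \<U> \<and> (\<forall>q. ultrafilter_on X q \<longrightarrow> q \<notin> \<Union>\<G> \<longrightarrow> \<F> \<subseteq> q)"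
          by simp
        then obtain \<G> where \<G>: "finite \<G>" "\<G> \<subseteq> \<U>"
            "\<forall>q. ultrafilter_on X q \<longrightarrow> q \<notin> \<Union>\<G> \<longrightarrow> \<F> \<subseteq> q"
          by (elim exE conjE) (rule that)
        from insert.prems have "C \<in> ?B" by simp
        then obtain A U where A: "A \<subseteq> X" "U \<in> \<U>" "?S A \<subseteq> U" "C = X - A"
          by blast
        have "C \<in> q" if "ultrafilter_on X q" "q \<notin> U" for q
          using that A(3) ultrafilter_onD(6)[OF that(1) A(1)] unfolding A(4) by blast
        then show ?case using \<G> A(2) by (intro exI[of _ "insert U \<G>"]) simp
      qed auto
      then obtain \<G> where \<G>: "finite \<G>" "\<G> \<subseteq> \<U>"
            "\<forall>q. ultrafilter_on X q \<longrightarrow> q \<notin> \<Union>\<G> \<longrightarrow> \<F> \<subseteq> q"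
        by (elim exE conjE) (rule that)
      have "\<not> {q. ultrafilter_on X q} \<subseteq> \<Union>\<G>"
        using no \<G>(1,2) unfolding topspace_stone_topology by metis
      then obtain q where q: "ultrafilter_on X q" "q \<notin> \<Union>\<G>" by blast
      with \<G>(3) have "\<F> \<subseteq> q" by simp
      with q(1) \<open>finite \<F>\<close> have "{x \<in> X. \<forall>A\<in>\<F>. x \<in> A} \<in> q"
        by (intro ultrafilter_on_Inter) auto
      then have "{x \<in> X. \<forall>A\<in>\<F>. x \<in> A} \<noteq> {}" using ultrafilter_onD(3)[OF q(1)] by metis
      then show "X \<inter> \<Inter>\<F> \<noteq> {}" by blast
    qed auto
    then obtain U where U: "U \<in> \<U>" "p \<in> U" using cov by auto
    then obtain A where A: "A \<in> p" "?S A \<subseteq> U"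
      using op unfolding openin_stone_topology by (metis (no_types, lifting) mem_Collect_eq subsetI)
    have AX: "A \<subseteq> X" using A(1) ultrafilter_onD(1)[OF p(1)] by simp
    then have "X - A \<in> ?B" using U(1) A(2) by blast
    then show False using p A(1) ultrafilter_onD(6)[OF p(1) AX] by blast
  qed
qed

lemma Hausdorff_space_stone_topology: "Hausdorff_space (stone_topology X)"
  unfolding Hausdorff_space_def
proof (intro allI impI; elim conjE)
  fix p q assume pq: "p \<in> topspace (stone_topology X)" "q \<in> topspace (stone_topology X)" "p \<noteq> q"
  then obtain A where A: "A \<in> p" "A \<notin> q" using ultrafilter_on_eqI[of X p q] by auto
  then have "A \<subseteq> X" using pq ultrafilter_onD(1) by auto
  show "\<exists>U V. openin (stone_topology X) U \<and> openin (stone_topology X) V \<and> p \<in> U \<and> q \<in> V \<and> disjnt U V"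
    using A pq
    by (intro exI[of _ "{p. ultrafilter_on X p \<and> A \<in> p}"] exI[of _ "{p. ultrafilter_on X p \<and> X - A \<in> p}"])
      (auto simp: openin_stone_basis disjnt_def ultrafilter_onD(6)[OF _ \<open>A \<subseteq> X\<close>])
qed

section \<open>Products and images of ultrafilters\<close>

definition uf_mult :: "'a set \<Rightarrow> ('a \<Rightarrow> 'a \<Rightarrow> 'a) \<Rightarrow> 'a set set \<Rightarrow> 'a set set \<Rightarrow> 'a set set" where
  "uf_mult X f p q = {A. A \<subseteq> X \<and> {x \<in> X. {y \<in> X. f x y \<in> A} \<in> q} \<in> p}"

definition uf_image :: "'a set \<Rightarrow> 'b set \<Rightarrow> ('a \<Rightarrow> 'b) \<Rightarrow> 'a set set \<Rightarrow> 'b set set" where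
  "uf_image X Y h p = {B. B \<subseteq> Y \<and> {x \<in> X. h x \<in> B} \<in> p}"

lemma ultrafilter_on_uf_image:
  assumes p: "ultrafilter_on X p" and h: "\<And>x. x \<in> X \<Longrightarrow> h x \<in> Y"
  shows "ultrafilter_on Y (uf_image X Y h p)"
proof -
  have "{x \<in> X. h x \<in> Y} = X" "{x \<in> X. h x \<in> A \<and> h x \<in> B} = {x \<in> X. h x \<in> A} \<inter> {x \<in> X. h x \<in> B}"
    "{x \<in> X. h x \<in> Y \<and> h x \<notin> A} = X - {x \<in> X. h x \<in> A}" for A B
    using h by auto
  moreover have "{x \<in> X. h x \<in> B} \<in> p" if "{x \<in> X. h x \<in> A} \<in> p" "A \<subseteq> B" for A B
    using that ultrafilter_onD(5)[OF p that(1), of "{x \<in> X. h x \<in> B}"] by blast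
  ultimately show ?thesis
    unfolding ultrafilter_on_def[of Y] uf_image_def
    using ultrafilter_onD(2-4,6)[OF p] by auto
qed

locale semigroup_carrier =
  fixes X :: "'a set" and f :: "'a \<Rightarrow> 'a \<Rightarrow> 'a"
  assumes closed: "\<lbrakk>x \<in> X; y \<in> X\<rbrakk> \<Longrightarrow> f x y \<in> X"
    and assoc: "\<lbrakk>x \<in> X; y \<in> X; z \<in> X\<rbrakk> \<Longrightarrow> f (f x y) z = f x (f y z)"
begin

text \<open>The map \<open>?D\<close> respects the Boolean operations because \<open>q\<close> is an
  ultrafilter, and the product consists of the subsets of \<open>X\<close> that \<open>?D\<close>
  sends into \<open>p\<close>.\<close>

lemma ultrafilter_on_uf_mult:
  assumes p: "ultrafilter_on X p" and q: "ultrafilter_on X q"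
  shows "ultrafilter_on X (uf_mult X f p q)"
proof -
  let ?D = "\<lambda>A. {x \<in> X. {y \<in> X. f x y \<in> A} \<in> q}"
  have mono: "{y \<in> X. f x y \<in> B} \<in> q" if "{y \<in> X. f x y \<in> A} \<in> q" "A \<subseteq> B" for x A B
    using that ultrafilter_onD(5)[OF q that(1), of "{y \<in> X. f x y \<in> B}"] by blast
  have "?D X = X"
    using ultrafilter_onD(2)[OF q] closed by (auto simp: Collect_conj_eq Int_absorb2 subset_iff)
  moreover have "?D {} = {}" using ultrafilter_onD(3)[OF q] by simp
  moreover have "?D (A \<inter> B) = ?D A \<inter> ?D B" for A B
  proof -
    have "{y \<in> X. f x y \<in> A \<inter> B} = {y \<in> X. f x y \<in> A} \<inter> {y \<in> X. f x y \<in> B}" for x by auto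
    then show ?thesis using ultrafilter_on_Int_iff[OF q] by auto
  qed
  moreover have "?D B \<in> p" if "?D A \<in> p" "A \<subseteq> B" for A B
    using ultrafilter_onD(5)[OF p that(1), of "?D B"] mono that(2) by blast
  moreover have "?D (X - A) = X - ?D A" for A
  proof -
    have "{y \<in> X. f x y \<in> X - A} = X - {y \<in> X. f x y \<in> A}" if "x \<in> X" for x using closed that by auto
    then show ?thesis using ultrafilter_onD(6)[OF q] by auto
  qed
  ultimately show ?thesis
    unfolding ultrafilter_on_def[of X "uf_mult X f p q"] unfolding uf_mult_def
    using ultrafilter_onD(2-4)[OF p] ultrafilter_onD(6)[OF p, of "?D _"] by auto
qed

lemma uf_mult_assoc:
  assumes p: "ultrafilter_on X p" and q: "ultrafilter_on X q" and r: "ultrafilter_on X r"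
  shows "uf_mult X f (uf_mult X f p q) r = uf_mult X f p (uf_mult X f q r)"
proof -
  have "A \<in> uf_mult X f (uf_mult X f p q) r \<longleftrightarrow> A \<in> uf_mult X f p (uf_mult X f q r)" if "A \<subseteq> X" for A
  proof -
    have 1: "{z \<in> X. f (f x y) z \<in> A} = {z \<in> X. f y z \<in> {w \<in> X. f x w \<in> A}}" if "x \<in> X" "y \<in> X" for x y
      using that closed assoc by auto
    have 2: "{y \<in> X. f x y \<in> {w \<in> X. {z \<in> X. f w z \<in> A} \<in> r}}
        = {y \<in> X. {z \<in> X. f y z \<in> {w \<in> X. f x w \<in> A}} \<in> r}" if "x \<in> X" for x
      using that closed 1 by auto
    have 3: "{x \<in> X. {y \<in> X. f x y \<in> {w \<in> X. {z \<in> X. f w z \<in> A} \<in> r}} \<in> q}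
        = {x \<in> X. {y \<in> X. {z \<in> X. f y z \<in> {w \<in> X. f x w \<in> A}} \<in> r} \<in> q}"
      using 2 by auto
    then show ?thesis using that by (simp add: uf_mult_def)
  qed
  then show ?thesis by (auto simp: uf_mult_def)
qed

sublocale beta: compact_right_topological_semigroup "stone_topology X" "uf_mult X f"
proof
  show "continuous_map (stone_topology X) (stone_topology X) (\<lambda>p. uf_mult X f p q)"
    if "q \<in> topspace (stone_topology X)" for q
    unfolding continuous_map_def
  proof (intro conjI allI impI)
    have q: "ultrafilter_on X q" using that by simp
    show "(\<lambda>p. uf_mult X f p q) \<in> topspace (stone_topology X) \<rightarrow> topspace (stone_topology X)"
      using ultrafilter_on_uf_mult[OF _ q] by simp
    fix U assume U: "openin (stone_topology X) U"
    show "openin (stone_topology X) {p \<in> topspace (stone_topology X). uf_mult X f p q \<in> U}"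
      unfolding openin_stone_topology
    proof (intro conjI ballI)
      fix p assume "p \<in> {p \<in> topspace (stone_topology X). uf_mult X f p q \<in> U}"
      then have p: "ultrafilter_on X p" "uf_mult X f p q \<in> U" by auto
      then obtain A where A: "A \<in> uf_mult X f p q" "\<And>r. ultrafilter_on X r \<and> A \<in> r \<Longrightarrow> r \<in> U"
        using U unfolding openin_stone_topology by metis
      \<comment> \<open>The preimage of a basic open set is basic: A belongs to the product of r and
        q iff \<open>{x \<in> X. {y \<in> X. f x y \<in> A} \<in> q}\<close> belongs to r.\<close>
      show "\<exists>A\<in>p. \<forall>r. ultrafilter_on X r \<and> A \<in> r \<longrightarrow>
          r \<in> {p \<in> topspace (stone_topology X). uf_mult X f p q \<in> U}"
        using A ultrafilter_on_uf_mult[OF _ q]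
        by (intro bexI[of _ "{x \<in> X. {y \<in> X. f x y \<in> A} \<in> q}"]) (auto simp: uf_mult_def)
    qed auto
  qed
qed (auto simp: compact_space_stone_topology Hausdorff_space_stone_topology
    ultrafilter_on_uf_mult uf_mult_assoc)

text \<open>The set \<open>D\<close> may depend on \<open>x\<close>. In the applications x is a sum
  along a chain, and \<open>D\<close> consists of sums along chains strictly above its last
  link.\<close>

lemma mem_uf_mult:
  assumes p: "ultrafilter_on X p" and q: "ultrafilter_on X q"
    and B: "B \<in> p" and C: "C \<subseteq> X"
    and step: "\<And>x. x \<in> B \<Longrightarrow> \<exists>D\<in>q. \<forall>y\<in>D. f x y \<in> C"
  shows "C \<in> uf_mult X f p q"
proof -
  have "{y \<in> X. f x y \<in> C} \<in> q" if x: "x \<in> B" for x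
  proof -
    obtain D where "D \<in> q" "\<forall>y\<in>D. f x y \<in> C" using step[OF x] by blast
    then show ?thesis
      using ultrafilter_onD(5)[OF q, of D "{y \<in> X. f x y \<in> C}"] ultrafilter_onD(1)[OF q] by blast
  qed
  then have "{x \<in> X. {y \<in> X. f x y \<in> C} \<in> q} \<in> p"
    using ultrafilter_onD(5)[OF p B, of "{x \<in> X. {y \<in> X. f x y \<in> C} \<in> q}"]
      ultrafilter_onD(1)[OF p B] by blast
  then show ?thesis using C by (simp add: uf_mult_def)
qed

end

lemma uf_image_uf_mult:
  assumes X: "semigroup_carrier X f" and Y: "semigroup_carrier Y g"
    and p: "ultrafilter_on X p" and q: "ultrafilter_on X q"
    and h: "\<And>x. x \<in> X \<Longrightarrow> h x \<in> Y"
    and hom: "\<And>x y. \<lbrakk>x \<in> X; y \<in> X\<rbrakk> \<Longrightarrow> h (f x y) = g (h x) (h y)"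
  shows "uf_image X Y h (uf_mult X f p q) = uf_mult Y g (uf_image X Y h p) (uf_image X Y h q)"
proof -
  interpret X: semigroup_carrier X f by fact
  have 1: "{z \<in> X. f x z \<in> {y \<in> X. h y \<in> B}} = {z \<in> X. h z \<in> {y \<in> Y. g (h x) y \<in> B}}" if "x \<in> X" for x B
    using that X.closed h hom by auto
  have "{x \<in> X. {z \<in> X. f x z \<in> {y \<in> X. h y \<in> B}} \<in> q}
      = {x \<in> X. h x \<in> {w \<in> Y. {z \<in> X. h z \<in> {y \<in> Y. g w y \<in> B}} \<in> q}}" for B
    using 1 h by auto
  then show ?thesis by (auto simp: uf_image_def uf_mult_def)
qed

section \<open>Block sums along chains of finite sets\<close>

text \<open>\<open>K\<close> is the last link used so far; \<open>{}\<close> can start because every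
  member of \<open>Pf X\<close> properly contains it. Chain members outside the blocks leave no
  trace, since strict inclusion is transitive and only contributing links are recorded.\<close>

inductive block_sums :: "('a set \<Rightarrow> 'a \<Rightarrow> nat) \<Rightarrow> 'a set \<Rightarrow> 'a set \<Rightarrow> nat list \<Rightarrow> bool"
  for v X where
  empty: "block_sums v X {} []"
| new_block: "\<lbrakk>block_sums v X L xs; L \<subset> K; K \<in> Pf X; f \<in> K\<rbrakk> \<Longrightarrow> block_sums v X K (xs @ [v K f])"
| extend_block: "\<lbrakk>block_sums v X L (xs @ [x]); L \<subset> K; K \<in> Pf X; f \<in> K\<rbrakk>
    \<Longrightarrow> block_sums v X K (xs @ [x + v K f])"

text \<open>These are the entries that can follow a list of block sums whose last link is
  \<open>F\<close>.\<close>

inductive chain_sum :: "('a set \<Rightarrow> 'a \<Rightarrow> nat) \<Rightarrow> 'a set \<Rightarrow> 'a set \<Rightarrow> 'a set \<Rightarrow> nat \<Rightarrow> bool"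
  for v X F where
  single: "\<lbrakk>F \<subset> K; K \<in> Pf X; f \<in> K\<rbrakk> \<Longrightarrow> chain_sum v X F K (v K f)"
| append: "\<lbrakk>chain_sum v X F L x; L \<subset> K; K \<in> Pf X; f \<in> K\<rbrakk> \<Longrightarrow> chain_sum v X F K (x + v K f)"

text \<open>The first link of the chain sum opens a new block and the later ones extend it.\<close>

lemma block_sums_append_chain_sum:
  assumes "chain_sum v X K L x" "block_sums v X K xs"
  shows "block_sums v X L (xs @ [x])"
  using assms by induction (auto intro: block_sums.intros)

lemma chain_sum_psubset: "chain_sum v X F K x \<Longrightarrow> F \<subset> K \<and> K \<in> Pf X"
  by (induction rule: chain_sum.induct) auto

lemma chain_sum_mono: "\<lbrakk>chain_sum v X F K x; E \<subseteq> F\<rbrakk> \<Longrightarrow> chain_sum v X E K x"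
  by (induction rule: chain_sum.induct) (blast intro: chain_sum.intros)+

text \<open>Chains are concatenated at \<open>L\<close>; this is what makes \<open>Q\<close> closed
  under addition.\<close>

lemma chain_sum_trans:
  assumes "chain_sum v X L K y" "chain_sum v X F L x"
  shows "chain_sum v X F K (x + y)"
  using assms
proof induction
  case (append L' y K f)
  then show ?case using chain_sum.append[of v X F L' "x + y" K f] by (simp add: add.assoc)
qed (auto intro: chain_sum.intros)

lemma block_sums_finite_subset: "block_sums v X K xs \<Longrightarrow> finite K \<and> K \<subseteq> X"
  by (induction rule: block_sums.induct) (auto simp: Pf_def)

text \<open>Only values at subsets of \<open>K\<close> enter, so block sums with last link
  \<open>K\<close> are available while \<open>v\<close> is still being defined by recursion on
  finite sets.\<close>

lemma block_sums_cong:
  assumes "block_sums v X K xs" "\<And>L. L \<subseteq> K \<Longrightarrow> v L = w L"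
  shows "block_sums w X K xs"
  using assms
proof induction
  case (new_block L xs K f)
  then have "block_sums w X L xs" by (metis psubset_imp_subset subset_trans)
  then show ?case using block_sums.new_block[of w X L xs K f] new_block by simp
next
  case (extend_block L xs x K f)
  then have "block_sums w X L (xs @ [x])" by (metis psubset_imp_subset subset_trans)
  then show ?case using block_sums.extend_block[of w X L xs x K f] extend_block by simp
qed (rule block_sums.empty)

text \<open>The link before \<open>K\<close> is one of finitely many proper subsets, to which
  induction applies, and the last summand comes from one of finitely many elements of
  \<open>K\<close>.\<close>

lemma finite_block_sums:
  assumes "finite K"
  shows "finite {xs. block_sums v X K xs}"
  using assms
proof (induction rule: finite_psubset_induct)
  case (psubset K)
  let ?S = "\<lambda>L. {xs. block_sums v X L xs}"
  have "?S K \<subseteq> insert [] (\<Union>L\<in>{L. L \<subset> K}. \<Union>f\<in>K.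
      (\<lambda>xs. xs @ [v K f]) ` ?S L \<union> (\<lambda>xs. butlast xs @ [last xs + v K f]) ` ?S L)"
  proof
    fix xs assume "xs \<in> ?S K"
    then have "block_sums v X K xs" by simp
    then show "xs \<in> insert [] (\<Union>L\<in>{L. L \<subset> K}. \<Union>f\<in>K.
      (\<lambda>xs. xs @ [v K f]) ` ?S L \<union> (\<lambda>xs. butlast xs @ [last xs + v K f]) ` ?S L)"
    proof cases
      case (new_block L ys f)
      then show ?thesis by blast
    next
      case (extend_block L ys y f)
      \<comment> \<open>Written with \<open>butlast\<close> and \<open>last\<close>, extending a
        block is a function of the whole list, so its results form the image of a finite
        set.\<close>
      then have "xs = (\<lambda>xs. butlast xs @ [last xs + v K f]) (ys @ [y])" by simp
      with extend_block show ?thesis by blast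
    qed simp
  qed
  moreover have "finite {L. L \<subset> K}"
    using psubset.hyps finite_Pow_iff by (rule_tac finite_subset[of _ "Pow K"]) auto
  ultimately show ?case
    using psubset by (elim finite_subset) auto
qed

text \<open>Indices are added in increasing order: the least one opens the block and every later one
  extends it.\<close>

lemma block_sums_append_block:
  assumes "block_sums v X L xs" "finite B" "B \<noteq> {}"
    and "\<And>i. i \<in> B \<Longrightarrow> L \<subset> G i \<and> G i \<in> Pf X \<and> f i \<in> G i"
    and "\<And>i j. \<lbrakk>i \<in> B; j \<in> B; i < j\<rbrakk> \<Longrightarrow> G i \<subset> G j"
  shows "block_sums v X (G (Max B)) (xs @ [\<Sum>i\<in>B. v (G i) (f i)])"
  using assms(2-)
proof (induction B rule: finite_linorder_max_induct)
  case (insert b B)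
  have b: "G b \<in> Pf X" "f b \<in> G b" "L \<subset> G b" using insert.prems by auto
  show ?case
  proof (cases "B = {}")
    case True
    then show ?thesis using block_sums.new_block[OF assms(1) b(3,1,2)] by simp
  next
    case False
    have IH: "block_sums v X (G (Max B)) (xs @ [\<Sum>i\<in>B. v (G i) (f i)])"
      using insert.IH False insert.prems by simp
    have "G (Max B) \<subset> G b" using insert False by simp
    then have "block_sums v X (G b) (xs @ [(\<Sum>i\<in>B. v (G i) (f i)) + v (G b) (f b)])"
      using block_sums.extend_block[OF IH _ b(1,2)] by simp
    moreover have "Max (insert b B) = b" using insert.hyps by (intro Max_eqI) auto
    moreover have "b \<notin> B" using insert.hyps by auto
    ultimately show ?thesis using insert.hyps by (simp add: add.commute)
  qed
qed simp

text \<open>Each block is put on top of the chain member at the maximum of the preceding block;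
  chain members in between are skipped.\<close>

lemma block_sums_of_blocks:
  assumes G: "\<And>i. i \<in> {1..n} \<Longrightarrow> G i \<in> Pf X \<and> f i \<in> G i"
    and chain: "\<And>i. i \<in> {1..<n} \<Longrightarrow> G i \<subset> G (i + 1)"
    and \<beta>: "\<And>j. j \<in> {1..m} \<Longrightarrow> \<beta> j \<in> Pf posnat"
    and less: "\<And>j. j \<in> {1..<m} \<Longrightarrow> block_less (\<beta> j) (\<beta> (j + 1))"
    and "m \<ge> 1" "Max (\<beta> m) \<le> n"
  shows "block_sums v X (G (Max (\<beta> m))) (map (\<lambda>j. \<Sum>i\<in>\<beta> j. v (G i) (f i)) [1..<m + 1])"
proof -
  have mono: "G i \<subset> G j" if "1 \<le> i" "i < j" "j \<le> n" for i j
    using that(2,3)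
  proof (induction j)
    case (Suc j)
    then have "G j \<subset> G (j + 1)" using that(1) by (intro chain) auto
    then show ?case using Suc by (cases "i = j") auto
  qed simp
  have fin: "finite (\<beta> j)" "\<beta> j \<noteq> {}" "\<And>i. i \<in> \<beta> j \<Longrightarrow> 1 \<le> i" if "j \<in> {1..m}" for j
    using \<beta>[OF that] by (auto simp: Pf_def)
  \<comment> \<open>Induction downwards from \<open>m\<close>: the bound is assumed for the last
    block only, and the maxima increase with j.\<close>
  have le: "Max (\<beta> j) \<le> n" if "1 \<le> j" "j \<le> m" for j
    using that(2,1)
  proof (induction j rule: inc_induct)
    case (step j)
    have "Min (\<beta> (Suc j)) \<le> Max (\<beta> (Suc j))" using fin[of "Suc j"] step.hyps by simp
    then show ?case using less[of j] step by (simp add: block_less_def)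
  qed (use assms in simp)
  have range: "1 \<le> i \<and> i \<le> n" if "i \<in> \<beta> j" "j \<in> {1..m}" for i j
  proof -
    have "i \<le> Max (\<beta> j)" "Max (\<beta> j) \<le> n" "1 \<le> i"
      using fin[OF that(2)] that le[of j] by auto
    then show ?thesis by simp
  qed
  have "block_sums v X (G (Max (\<beta> k))) (map (\<lambda>j. \<Sum>i\<in>\<beta> j. v (G i) (f i)) [1..<k + 1])"
    if "1 \<le> k" "k \<le> m" for k
    using that
  proof (induction k rule: dec_induct)
    case base
    have "block_sums v X (G (Max (\<beta> 1))) ([] @ [\<Sum>i\<in>\<beta> 1. v (G i) (f i)])"
    proof (rule block_sums_append_block[OF block_sums.empty])
      show "{} \<subset> G i \<and> G i \<in> Pf X \<and> f i \<in> G i" if "i \<in> \<beta> 1" for i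
        using G[of i] range[OF that] \<open>m \<ge> 1\<close> by (auto simp: Pf_def)
      have 1: "1 \<in> {1..m}" using \<open>m \<ge> 1\<close> by simp
      show "G i \<subset> G j" if "i \<in> \<beta> 1" "j \<in> \<beta> 1" "i < j" for i j
        using range[OF that(1) 1] range[OF that(2) 1] that(3) by (intro mono) auto
      show "finite (\<beta> 1)" "\<beta> 1 \<noteq> {}" using fin[OF 1] by auto
    qed
    then show ?case by simp
  next
    case (step k)
    let ?xs = "map (\<lambda>j. \<Sum>i\<in>\<beta> j. v (G i) (f i)) [1..<k + 1]"
    have lt: "Max (\<beta> k) < Min (\<beta> (Suc k))" using less[of k] step by (simp add: block_less_def)
    have k: "k \<in> {1..m}" "Suc k \<in> {1..m}" using step by auto
    have "block_sums v X (G (Max (\<beta> (Suc k)))) (?xs @ [\<Sum>i\<in>\<beta> (Suc k). v (G i) (f i)])"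
    proof (rule block_sums_append_block)
      show "block_sums v X (G (Max (\<beta> k))) ?xs" using step by simp
      show "G (Max (\<beta> k)) \<subset> G i \<and> G i \<in> Pf X \<and> f i \<in> G i" if i: "i \<in> \<beta> (Suc k)" for i
      proof -
        have "Max (\<beta> k) < i" using lt Min_le[OF fin(1)[OF k(2)] i] by linarith
        moreover have "1 \<le> Max (\<beta> k)" using Max_in fin[OF k(1)] by blast
        ultimately show ?thesis using G[of i] range[OF i k(2)] mono by auto
      qed
      show "G i \<subset> G j" if "i \<in> \<beta> (Suc k)" "j \<in> \<beta> (Suc k)" "i < j" for i j
        using range[OF that(1) k(2)] range[OF that(2) k(2)] that(3) by (intro mono) auto
    qed (use fin[OF k(2)] in auto)
    then show ?case using step.hyps by simp
  qed
  then show ?thesis using \<open>m \<ge> 1\<close> by simp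
qed

text \<open>The induction invariant for the converse translation. It ties the end of the chain to
  \<open>K\<close>, allows the empty chain at \<open>n = 0\<close>, and compares blocks elementwise,
  which avoids \<open>Max\<close> and \<open>Min\<close> of sets still growing.\<close>

definition block_witness where
  "block_witness v X K xs n G \<beta> f \<longleftrightarrow> length xs \<le> n \<and> (n = 0 \<longrightarrow> K = {}) \<and> (n > 0 \<longrightarrow> G n = K) \<and>
    (\<forall>i\<in>{1..n}. G i \<in> Pf X \<and> f i \<in> G i) \<and> (\<forall>i\<in>{1..<n}. G i \<subset> G (i + 1)) \<and>
    (\<forall>j\<in>{1..length xs}. \<beta> j \<noteq> {} \<and> \<beta> j \<subseteq> {1..n}) \<and>
    (\<forall>j\<in>{1..<length xs}. \<forall>a\<in>\<beta> j. \<forall>b\<in>\<beta> (j + 1). a < b) \<and>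
    xs = map (\<lambda>j. \<Sum>i\<in>\<beta> j. v (G i) (f i)) [1..<length xs + 1]"

lemma block_witnessD:
  assumes "block_witness v X K xs n G \<beta> f"
  shows "length xs \<le> n" "n = 0 \<Longrightarrow> K = {}" "n > 0 \<Longrightarrow> G n = K"
    "i \<in> {1..n} \<Longrightarrow> G i \<in> Pf X \<and> f i \<in> G i" "i \<in> {1..<n} \<Longrightarrow> G i \<subset> G (i + 1)"
    "j \<in> {1..length xs} \<Longrightarrow> \<beta> j \<noteq> {} \<and> \<beta> j \<subseteq> {1..n}"
    "\<lbrakk>j \<in> {1..<length xs}; a \<in> \<beta> j; b \<in> \<beta> (j + 1)\<rbrakk> \<Longrightarrow> a < b"
    "xs = map (\<lambda>j. \<Sum>i\<in>\<beta> j. v (G i) (f i)) [1..<length xs + 1]"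
  using assms unfolding block_witness_def by blast+

text \<open>Each growth rule makes \<open>K\<close> the chain member number \<open>Suc n\<close>:
  \<open>new_block\<close> opens a block with this index, \<open>extend_block\<close> puts it into
  the last block. Every block thus has an index of its own, whence
  \<open>length xs \<le> n\<close>.\<close>

lemma blocks_of_block_sums:
  assumes "block_sums v X K xs"
  obtains n G \<beta> f where "length xs \<le> n"
    "\<And>i. i \<in> {1..n} \<Longrightarrow> G i \<in> Pf X \<and> f i \<in> G i" "\<And>i. i \<in> {1..<n} \<Longrightarrow> G i \<subset> G (i + 1)"
    "\<And>j. j \<in> {1..length xs} \<Longrightarrow> \<beta> j \<in> Pf posnat \<and> Max (\<beta> j) \<le> n"
    "\<And>j. j \<in> {1..<length xs} \<Longrightarrow> block_less (\<beta> j) (\<beta> (j + 1))"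
    "xs = map (\<lambda>j. \<Sum>i\<in>\<beta> j. v (G i) (f i)) [1..<length xs + 1]"
proof -
  have "\<exists>n G \<beta> f. block_witness v X K xs n G \<beta> f"
    using assms
  proof induction
    case empty
    show ?case
      by (rule exI[of _ 0], rule exI[of _ "\<lambda>_. {}"], rule exI[of _ "\<lambda>_. {}"], rule exI)
        (simp add: block_witness_def)
  next
    case (new_block L xs K g)
    then obtain n G \<beta> f where w: "block_witness v X L xs n G \<beta> f" by blast
    note n = block_witnessD(1-3)[OF w] and G = block_witnessD(4,5)[OF w]
      and \<beta> = block_witnessD(6,7)[OF w] and xs = block_witnessD(8)[OF w]
    let ?G = "G(Suc n := K)" and ?f = "f(Suc n := g)" and ?\<beta> = "\<beta>(Suc (length xs) := {Suc n})"
    have "map (\<lambda>j. \<Sum>i\<in>?\<beta> j. v (?G i) (?f i)) [1..<length xs + 1]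
        = map (\<lambda>j. \<Sum>i\<in>\<beta> j. v (G i) (f i)) [1..<length xs + 1]"
    proof (rule map_cong[OF refl])
      fix j assume "j \<in> set [1..<length xs + 1]"
      then have "j \<in> {1..length xs}" by auto
      with \<beta>(1)[OF this] show "(\<Sum>i\<in>?\<beta> j. v (?G i) (?f i)) = (\<Sum>i\<in>\<beta> j. v (G i) (f i))"
        by (intro sum.cong) auto
    qed
    also have "\<dots> = xs" using xs by simp
    finally have "xs @ [v K g] = map (\<lambda>j. \<Sum>i\<in>?\<beta> j. v (?G i) (?f i)) [1..<length (xs @ [v K g]) + 1]"
      by simp
    moreover have "\<forall>i\<in>{1..<Suc n}. ?G i \<subset> ?G (i + 1)"
    proof
      fix i assume "i \<in> {1..<Suc n}"
      then show "?G i \<subset> ?G (i + 1)"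
        using G(2)[of i] n(3) \<open>L \<subset> K\<close> by (cases "i = n") simp_all
    qed
    moreover have "\<forall>j\<in>{1..<length (xs @ [v K g])}. \<forall>a\<in>?\<beta> j. \<forall>b\<in>?\<beta> (j + 1). a < b"
    proof (intro ballI)
      fix j a b assume j: "j \<in> {1..<length (xs @ [v K g])}" and ab: "a \<in> ?\<beta> j" "b \<in> ?\<beta> (j + 1)"
      then have a: "a \<in> \<beta> j" "\<beta> j \<subseteq> {1..n}" using \<beta>(1)[of j] by simp_all
      show "a < b"
      proof (cases "j = length xs")
        case True
        then show ?thesis using a ab by auto
      next
        case False
        then show ?thesis using \<beta>(2)[of j a b] a(1) ab j by simp
      qed
    qed
    moreover have "\<forall>j\<in>{1..length (xs @ [v K g])}. ?\<beta> j \<noteq> {} \<and> ?\<beta> j \<subseteq> {1..Suc n}"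
    proof
      fix j assume "j \<in> {1..length (xs @ [v K g])}"
      then show "?\<beta> j \<noteq> {} \<and> ?\<beta> j \<subseteq> {1..Suc n}"
        using \<beta>(1)[of j] by (cases "j = Suc (length xs)") auto
    qed
    moreover have "\<forall>i\<in>{1..Suc n}. ?G i \<in> Pf X \<and> ?f i \<in> ?G i"
    proof
      fix i assume "i \<in> {1..Suc n}"
      then show "?G i \<in> Pf X \<and> ?f i \<in> ?G i"
        using G(1)[of i] new_block.hyps by (cases "i = Suc n") simp_all
    qed
    ultimately have "block_witness v X K (xs @ [v K g]) (Suc n) ?G ?\<beta> ?f"
      unfolding block_witness_def using n(1) by (intro conjI) (assumption | simp)+
    then show ?case by blast
  next
    case (extend_block L xs x K g)
    then obtain n G \<beta> f where w: "block_witness v X L (xs @ [x]) n G \<beta> f" by blast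
    note n = block_witnessD(1-3)[OF w] and G = block_witnessD(4,5)[OF w]
      and \<beta> = block_witnessD(6,7)[OF w] and xs = block_witnessD(8)[OF w]
    let ?k = "Suc (length xs)"
    let ?G = "G(Suc n := K)" and ?f = "f(Suc n := g)" and ?\<beta> = "\<beta>(?k := insert (Suc n) (\<beta> ?k))"
    \<comment> \<open>Chain and functions change only at \<open>Suc n\<close>, which lies in none of
      the old blocks.\<close>
    have old: "(\<Sum>i\<in>\<beta> j. v (?G i) (?f i)) = (\<Sum>i\<in>\<beta> j. v (G i) (f i))" if "j \<in> {1..?k}" for j
      using \<beta>(1)[of j] that by (intro sum.cong) auto
    have "xs = map (\<lambda>j. \<Sum>i\<in>\<beta> j. v (G i) (f i)) [1..<?k]" and x: "x = (\<Sum>i\<in>\<beta> ?k. v (G i) (f i))"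
      using xs by simp_all
    then have "xs = map (\<lambda>j. \<Sum>i\<in>?\<beta> j. v (?G i) (?f i)) [1..<?k]"
      using old by (subst \<open>xs = _\<close>, intro map_cong) auto
    moreover have "x + v K g = (\<Sum>i\<in>?\<beta> ?k. v (?G i) (?f i))"
    proof -
      have "finite (\<beta> ?k)" "Suc n \<notin> \<beta> ?k" using \<beta>(1)[of ?k] finite_subset by auto
      then show ?thesis using old[of ?k] x by simp
    qed
    ultimately have "xs @ [x + v K g]
        = map (\<lambda>j. \<Sum>i\<in>?\<beta> j. v (?G i) (?f i)) [1..<length (xs @ [x + v K g]) + 1]"
      by simp
    moreover have "\<forall>i\<in>{1..<Suc n}. ?G i \<subset> ?G (i + 1)"
    proof
      fix i assume "i \<in> {1..<Suc n}"
      then show "?G i \<subset> ?G (i + 1)"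
        using G(2)[of i] n(3) \<open>L \<subset> K\<close> by (cases "i = n") simp_all
    qed
    moreover have "\<forall>j\<in>{1..<length (xs @ [x + v K g])}. \<forall>a\<in>?\<beta> j. \<forall>b\<in>?\<beta> (j + 1). a < b"
    proof (intro ballI)
      fix j a b assume j: "j \<in> {1..<length (xs @ [x + v K g])}" and ab: "a \<in> ?\<beta> j" "b \<in> ?\<beta> (j + 1)"
      then have "a \<in> \<beta> j" by (simp split: if_splits)
      moreover have "b = Suc n \<or> b \<in> \<beta> (j + 1)" using ab(2) by (simp split: if_splits)
      moreover have "\<beta> j \<subseteq> {1..n}" using \<beta>(1)[of j] j by simp
      ultimately show "a < b" using \<beta>(2)[of j a b] j by auto
    qed
    moreover have "\<forall>j\<in>{1..length (xs @ [x + v K g])}. ?\<beta> j \<noteq> {} \<and> ?\<beta> j \<subseteq> {1..Suc n}"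
    proof
      fix j assume "j \<in> {1..length (xs @ [x + v K g])}"
      then have "\<beta> j \<noteq> {} \<and> \<beta> j \<subseteq> {1..n}" using \<beta>(1)[of j] by simp
      then show "?\<beta> j \<noteq> {} \<and> ?\<beta> j \<subseteq> {1..Suc n}"
        by (cases "j = ?k") auto
    qed
    moreover have "\<forall>i\<in>{1..Suc n}. ?G i \<in> Pf X \<and> ?f i \<in> ?G i"
    proof
      fix i assume "i \<in> {1..Suc n}"
      then show "?G i \<in> Pf X \<and> ?f i \<in> ?G i"
        using G(1)[of i] extend_block.hyps by (cases "i = Suc n") simp_all
    qed
    ultimately have "block_witness v X K (xs @ [x + v K g]) (Suc n) ?G ?\<beta> ?f"
      unfolding block_witness_def using n(1) by (intro conjI) (assumption | simp)+
    then show ?case by blast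
  qed
  then obtain n G \<beta> f where w: "block_witness v X K xs n G \<beta> f" by blast
  note n = block_witnessD(1)[OF w] and G = block_witnessD(4,5)[OF w]
    and \<beta> = block_witnessD(6,7)[OF w] and xs = block_witnessD(8)[OF w]
  have fin: "finite (\<beta> j)" if "j \<in> {1..length xs}" for j
    using \<beta>(1)[OF that] finite_subset by blast
  show thesis
  proof (rule that[OF n G _ _ xs])
    show "\<beta> j \<in> Pf posnat \<and> Max (\<beta> j) \<le> n" if "j \<in> {1..length xs}" for j
      using \<beta>(1)[OF that] fin[OF that] Max_in[of "\<beta> j"] by (auto simp: Pf_def)
    show "block_less (\<beta> j) (\<beta> (j + 1))" if j: "j \<in> {1..<length xs}" for j
    proof -
      have "Max (\<beta> j) \<in> \<beta> j" "Min (\<beta> (j + 1)) \<in> \<beta> (j + 1)"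
        using \<beta>(1)[of j] \<beta>(1)[of "j + 1"] fin[of j] fin[of "j + 1"] j by simp_all
      then show ?thesis unfolding block_less_def using \<beta>(2)[OF j] by blast
    qed
  qed
qed

section \<open>Tensor powers as iterated quantifiers\<close>

text \<open>The list holds the entries already chosen and the number counts those still to come, so
  a partial tuple can be continued.\<close>

fun iterated_uf :: "nat set set \<Rightarrow> (nat list \<Rightarrow> bool) \<Rightarrow> nat \<Rightarrow> nat list \<Rightarrow> bool" where
  "iterated_uf p P 0 xs \<longleftrightarrow> P xs"
| "iterated_uf p P (Suc r) xs \<longleftrightarrow> {x \<in> posnat. iterated_uf p P r (xs @ [x])} \<in> p"

text \<open>\<open>tensor\<close> peels off the last coordinate, \<open>iterated_uf\<close> the
  first. Induction is applied to the set \<open>?A'\<close> of prefixes, which absorbs the innermost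
  quantifier.\<close>

lemma mem_tensor_power_iff:
  assumes "A \<subseteq> tuples (Suc k)"
  shows "A \<in> tensor (\<lambda>i. p) (Suc k) \<longleftrightarrow> iterated_uf p (\<lambda>xs. xs \<in> A) (Suc k) []"
  using assms
proof (induction k arbitrary: A)
  case (Suc k)
  let ?A' = "{xs \<in> tuples (Suc k). {x \<in> posnat. xs @ [x] \<in> A} \<in> p}"
  \<comment> \<open>The condition \<open>j + r = Suc k\<close> ensures that the completed prefixes
    have the length demanded by \<open>?A'\<close>.\<close>
  have "iterated_uf p (\<lambda>xs. xs \<in> ?A') r xs \<longleftrightarrow> iterated_uf p (\<lambda>xs. xs \<in> A) (Suc r) xs"
    if "xs \<in> tuples j" "j + r = Suc k" for j r xs
    using that
  proof (induction r arbitrary: j xs)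
    case (Suc r)
    have "xs @ [x] \<in> tuples (Suc j)" if "x \<in> posnat" for x
      using Suc.prems(1) that by (auto simp: tuples_def)
    then have "{x \<in> posnat. iterated_uf p (\<lambda>xs. xs \<in> ?A') r (xs @ [x])}
        = {x \<in> posnat. iterated_uf p (\<lambda>xs. xs \<in> A) (Suc r) (xs @ [x])}"
      using Suc.IH[of _ "Suc j"] Suc.prems(2) by auto
    then show ?case by simp
  qed simp
  then have "iterated_uf p (\<lambda>xs. xs \<in> ?A') (Suc k) [] \<longleftrightarrow> iterated_uf p (\<lambda>xs. xs \<in> A) (Suc (Suc k)) []"
    by (simp add: tuples_def del: iterated_uf.simps)
  moreover have "?A' \<in> tensor (\<lambda>i. p) (Suc k) \<longleftrightarrow> iterated_uf p (\<lambda>xs. xs \<in> ?A') (Suc k) []"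
    by (rule Suc.IH) auto
  ultimately show ?case using Suc.prems by (simp del: iterated_uf.simps)
qed simp

section \<open>From an idempotent to the selection of sums\<close>

text \<open>The J-set property is applied to the maps sending t to f (t + N), and the index set
  found for them is translated by \<open>N\<close>.\<close>

lemma J_set_beyond:
  assumes "J_set A" "F \<in> Pf seqs"
  obtains a B where "a \<in> posnat" "B \<in> Pf posnat" "N < Min B" "\<forall>f\<in>F. a + (\<Sum>t\<in>B. f t) \<in> A"
proof -
  \<comment> \<open>Restriction to \<open>posnat\<close> keeps the shifted maps extensional, as
    membership in \<open>seqs\<close> demands.\<close>
  let ?s = "\<lambda>f. \<lambda>t\<in>posnat. f (t + N)"
  have "?s ` F \<in> Pf seqs"
    using assms(2) unfolding Pf_def by (auto simp: PiE_iff subset_iff)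
  with assms(1) have "\<exists>a\<in>posnat. \<exists>B\<in>Pf posnat. \<forall>g\<in>?s ` F. a + (\<Sum>t\<in>B. g t) \<in> A"
    unfolding J_set_def by (elim conjE) (rule bspec)
  then obtain a B where aB: "a \<in> posnat" "B \<in> Pf posnat" "\<forall>g\<in>?s ` F. a + (\<Sum>t\<in>B. g t) \<in> A"
    by (elim bexE) (rule that)
  have B: "finite B" "B \<noteq> {}" "B \<subseteq> posnat" using aB(2) by (auto simp: Pf_def)
  show thesis
  proof (rule that[of a "(\<lambda>t. t + N) ` B"])
    show "(\<lambda>t. t + N) ` B \<in> Pf posnat" using B by (auto simp: Pf_def)
    show "N < Min ((\<lambda>t. t + N) ` B)" using B by (subst Min_gr_iff) auto
    have sum: "(\<Sum>t\<in>(\<lambda>t. t + N) ` B. f t) = (\<Sum>t\<in>B. ?s f t)" for f :: "nat \<Rightarrow> nat"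
      using B(3) by (subst sum.reindex) (auto intro!: sum.cong)
    show "\<forall>f\<in>F. a + (\<Sum>t\<in>(\<lambda>t. t + N) ` B. f t) \<in> A"
      unfolding sum using bspec[OF aB(3) imageI] by (intro ballI)
  qed fact
qed

definition star :: "nat set set \<Rightarrow> nat set \<Rightarrow> nat set" where
  "star p A = {x \<in> A. shift x A \<in> p}"

lemma star_mem:
  assumes p: "ultrafilter_on posnat p" "idempotent_uf p" and A: "A \<in> p"
  shows "star p A \<in> p"
proof -
  have "A \<in> uf_add p p" using p(2) A by (simp add: idempotent_uf_def)
  then have "{x \<in> posnat. shift x A \<in> p} \<in> p" by (simp add: uf_add_def)
  then have "A \<inter> {x \<in> posnat. shift x A \<in> p} \<in> p" using ultrafilter_onD(4)[OF p(1) A] by simp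
  moreover have "A \<inter> {x \<in> posnat. shift x A \<in> p} = star p A"
    using ultrafilter_onD(1)[OF p(1) A] by (auto simp: star_def)
  ultimately show ?thesis by simp
qed

text \<open>Translation commutes with \<open>star\<close>, so the set equals
  \<open>star p (shift x A)\<close>; since \<open>shift x A\<close> is in \<open>p\<close>,
  \<open>star_mem\<close> applies to it.\<close>

lemma shift_star_mem:
  assumes p: "ultrafilter_on posnat p" "idempotent_uf p" and x: "x \<in> star p A"
  shows "shift x (star p A) \<in> p"
proof -
  have "shift (x + y) A = shift y (shift x A)" if "y \<in> posnat" for y
    using that by (auto simp: shift_def add.assoc)
  then have "shift x (star p A) = star p (shift x A)"
    by (auto simp: star_def shift_def[of x])
  moreover have "star p (shift x A) \<in> p" using x by (intro star_mem p) (simp add: star_def)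
  ultimately show ?thesis by simp
qed

abbreviation choice_sum :: "((nat \<Rightarrow> nat) set \<Rightarrow> nat \<times> nat set) \<Rightarrow> (nat \<Rightarrow> nat) set \<Rightarrow> (nat \<Rightarrow> nat) \<Rightarrow> nat" where
  "choice_sum c K f \<equiv> fst (c K) + (\<Sum>t\<in>snd (c K). f t)"

lemma idempotent_imp_selection:
  assumes p: "p \<in> J_ufs" "idempotent_uf p" and P: "iterated_uf p P m []"
  obtains c where "\<forall>F\<in>Pf seqs. c F \<in> posnat \<times> Pf posnat"
    "\<forall>F\<in>Pf seqs. \<forall>G\<in>Pf seqs. F \<subset> G \<longrightarrow> Max (snd (c F)) < Min (snd (c G))"
    "\<forall>K xs. block_sums (choice_sum c) seqs K xs \<and> length xs = m \<longrightarrow> P xs"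
proof -
  have up: "ultrafilter_on posnat p" and J: "\<And>A. A \<in> p \<Longrightarrow> J_set A"
    using p(1) by (auto simp: J_ufs_def betaN_def)
  \<comment> \<open>The next entries after \<open>xs\<close> that keep the iterated quantifier true
    with one choice fewer left.\<close>
  define D where "D xs = {x \<in> posnat. iterated_uf p P (m - Suc (length xs)) (xs @ [x])}" for xs
  \<comment> \<open>A last entry taken from \<open>star\<close> can still grow inside its block
    without leaving the permitted set.\<close>
  define good where "good xs \<longleftrightarrow>
    xs = [] \<or> D (butlast xs) \<in> p \<and> last xs \<in> star p (D (butlast xs))" for xs
  \<comment> \<open>Summands allowed after \<open>xs\<close>, both as a new entry and as an addition
    to the last one. At length \<open>m\<close> no further entry may begin, hence the guard.\<close>
  define N where "N xs = {y \<in> posnat. (length xs < m \<longrightarrow> y \<in> star p (D xs)) \<and>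
    (xs \<noteq> [] \<longrightarrow> last xs + y \<in> star p (D (butlast xs)))}" for xs
  have iter: "iterated_uf p P (m - length xs) xs" if "good xs" "length xs \<le> m" for xs
  proof (cases "xs = []")
    case False
    then have "last xs \<in> D (butlast xs)" using that(1) by (simp add: good_def star_def)
    moreover have "m - Suc (length (butlast xs)) = m - length xs" using False by simp
    ultimately show ?thesis using False by (simp add: D_def)
  qed (use P in simp)
  have D: "D xs \<in> p" if "good xs" "length xs < m" for xs
  proof -
    have "m - length xs = Suc (m - Suc (length xs))" using that(2) by simp
    then show ?thesis using iter[of xs] that by (simp add: D_def)
  qed
  have N: "N xs \<in> p" if "good xs" "length xs \<le> m" for xs
  proof -
    have "{y \<in> posnat. length xs < m \<longrightarrow> y \<in> star p (D xs)} \<in> p"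
    proof (cases "length xs < m")
      case True
      then have s: "star p (D xs) \<in> p" using D that(1) by (intro star_mem up p)
      then have "{y \<in> posnat. y \<in> star p (D xs)} = star p (D xs)" using ultrafilter_onD(1)[OF up s] by blast
      then show ?thesis using s True by simp
    next
      case False
      then show ?thesis using ultrafilter_onD(2)[OF up] by (simp add: atLeast_def)
    qed
    moreover have "{y \<in> posnat. xs \<noteq> [] \<longrightarrow> last xs + y \<in> star p (D (butlast xs))} \<in> p"
    proof (cases "xs = []")
      case True
      then show ?thesis using ultrafilter_onD(2)[OF up] by (simp add: atLeast_def)
    next
      case False
      then have "shift (last xs) (star p (D (butlast xs))) \<in> p"
        using that(1) by (intro shift_star_mem up p) (simp add: good_def)
      then show ?thesis using False by (simp add: shift_def)
    qed
    ultimately have "{y \<in> posnat. length xs < m \<longrightarrow> y \<in> star p (D xs)} \<inter>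
        {y \<in> posnat. xs \<noteq> [] \<longrightarrow> last xs + y \<in> star p (D (butlast xs))} \<in> p" (is "?N \<in> p")
      using ultrafilter_onD(4)[OF up] by blast
    moreover have "?N = N xs" by (auto simp: N_def)
    ultimately show ?thesis by simp
  qed
  have good_append: "good (xs @ [y])" if "good xs" "length xs < m" "y \<in> N xs" for xs y
    using that D by (simp add: good_def N_def)
  have good_extend: "good (xs @ [x + y])" if "good (xs @ [x])" "y \<in> N (xs @ [x])" for xs x y
    using that by (simp add: good_def N_def)
  \<comment> \<open>Admissibility of the pair \<open>r\<close>, standing for \<alpha> and H at
    \<open>F\<close>, refers to \<open>c\<close> only at proper subsets of \<open>F\<close>. Both
    growth rules of \<open>block_sums\<close> are served by the single requirement of lying in
    \<open>N xs\<close>.\<close>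
  define ok where "ok c F r \<longleftrightarrow> (F \<in> Pf seqs \<longrightarrow> r \<in> posnat \<times> Pf posnat \<and>
    (\<forall>K\<in>Pf seqs. K \<subset> F \<longrightarrow> Max (snd (c K)) < Min (snd r)) \<and>
    (\<forall>K xs f. K \<subset> F \<and> block_sums (choice_sum c) seqs K xs \<and> length xs \<le> m \<and> f \<in> F
      \<longrightarrow> fst r + (\<Sum>t\<in>snd r. f t) \<in> N xs))"
    for c :: "(nat \<Rightarrow> nat) set \<Rightarrow> nat \<times> nat set" and F and r :: "nat \<times> nat set"
  have good: "length xs \<le> m \<longrightarrow> good xs"
    if "block_sums (choice_sum c) seqs K xs" "\<And>L. L \<subseteq> K \<Longrightarrow> ok c L (c L)" for c K xs
    using that
  proof induction
    case empty
    show ?case by (simp add: good_def)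
  next
    case (new_block L xs K f)
    have "choice_sum c K f \<in> N xs" if "length xs \<le> m"
      using new_block.prems[of K] new_block.hyps that unfolding ok_def by blast
    moreover have "length xs \<le> m \<longrightarrow> good xs"
      using new_block.IH new_block.prems \<open>L \<subset> K\<close> by (meson psubset_imp_subset subset_trans)
    ultimately show ?case using good_append by simp
  next
    case (extend_block L xs x K f)
    have "choice_sum c K f \<in> N (xs @ [x])" if "length (xs @ [x]) \<le> m"
      using extend_block.prems[of K] extend_block.hyps that unfolding ok_def by blast
    moreover have "length (xs @ [x]) \<le> m \<longrightarrow> good (xs @ [x])"
      using extend_block.IH extend_block.prems \<open>L \<subset> K\<close> by (meson psubset_imp_subset subset_trans)
    ultimately show ?case using good_extend by simp
  qed
  \<comment> \<open>Recursion along proper inclusion of finite sets: \<open>ok\<close> depends on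
    \<open>c\<close> only below \<open>F\<close>, and an admissible value exists once the earlier
    values are admissible.\<close>
  have "\<exists>c. \<forall>F. ok c F (c F)"
  proof (rule dependent_wf_choice)
    show "wf {(K :: (nat \<Rightarrow> nat) set, F). K \<subset> F \<and> finite F}" using wf_finite_psubset unfolding finite_psubset_def .
  next
    fix c d :: "(nat \<Rightarrow> nat) set \<Rightarrow> nat \<times> nat set" and F r
    assume eq: "\<And>K. (K, F) \<in> {(K, F). K \<subset> F \<and> finite F} \<Longrightarrow> c K = d K"
    show "ok c F r = ok d F r"
    proof (cases "F \<in> Pf seqs")
      case True
      then have eq': "c K = d K" if "K \<subset> F" for K using eq that by (simp add: Pf_def)
      have "block_sums (choice_sum c) seqs K xs \<longleftrightarrow> block_sums (choice_sum d) seqs K xs" if "K \<subset> F" for K xs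
      proof -
        have ceq: "choice_sum c L = choice_sum d L" if "L \<subseteq> K" for L
          using eq'[of L] that \<open>K \<subset> F\<close> by (intro ext) auto
        show ?thesis
        proof
          show "block_sums (choice_sum d) seqs K xs" if "block_sums (choice_sum c) seqs K xs"
            using that ceq by (rule block_sums_cong)
          show "block_sums (choice_sum c) seqs K xs" if "block_sums (choice_sum d) seqs K xs"
            using that ceq[symmetric] by (rule block_sums_cong)
        qed
      qed
      then show ?thesis unfolding ok_def using eq' by (simp cong: conj_cong)
    qed (simp add: ok_def)
  next
    fix F and c :: "(nat \<Rightarrow> nat) set \<Rightarrow> nat \<times> nat set"
    assume IH: "\<And>K. (K, F) \<in> {(K, F). K \<subset> F \<and> finite F} \<Longrightarrow> ok c K (c K)"
    show "\<exists>r. ok c F r"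
    proof (cases "F \<in> Pf seqs")
      case F: True
      then have fin: "finite F" by (simp add: Pf_def)
      have sub: "finite {K. K \<subset> F}" using fin by (rule_tac finite_subset[of _ "Pow F"]) auto
      \<comment> \<open>The lists that can precede \<open>F\<close>. They are finite in number, so
        the intersection of their sets \<open>N xs\<close> is in \<open>p\<close> and therefore a
        J-set.\<close>
      let ?S = "(\<Union>K\<in>{K. K \<subset> F}. {xs. block_sums (choice_sum c) seqs K xs}) \<inter> {xs. length xs \<le> m}"
      have "finite ?S"
      proof (rule finite_Int[OF disjI1], rule finite_UN_I[OF sub])
        fix K assume "K \<in> {K. K \<subset> F}"
        then have "finite K" using finite_subset[OF _ fin] by auto
        then show "finite {xs. block_sums (choice_sum c) seqs K xs}" by (rule finite_block_sums)
      qed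
      moreover have "N xs \<in> p" if "xs \<in> ?S" for xs
      proof (rule N)
        obtain K where "K \<subset> F" "block_sums (choice_sum c) seqs K xs" using \<open>xs \<in> ?S\<close> by blast
        moreover have "ok c L (c L)" if "L \<subseteq> K" for L
          using IH[of L] that \<open>K \<subset> F\<close> fin by auto
        ultimately show "good xs" using good[of c K xs] \<open>xs \<in> ?S\<close> by simp
      qed (use \<open>xs \<in> ?S\<close> in simp)
      ultimately have "{x \<in> posnat. \<forall>xs\<in>?S. x \<in> N xs} \<in> p" by (intro ultrafilter_on_Inter up)
      \<comment> \<open>Starting beyond the maxima at all proper subsets at once gives (a) at
        \<open>F\<close>.\<close>
      then obtain a B where aB: "a \<in> posnat" "B \<in> Pf posnat"
        "Max (insert 0 ((\<lambda>K. Max (snd (c K))) ` {K. K \<subset> F})) < Min B"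
        "\<forall>f\<in>F. a + (\<Sum>t\<in>B. f t) \<in> {x \<in> posnat. \<forall>xs\<in>?S. x \<in> N xs}"
        by (rule J_set_beyond[OF J F])
      have "Max (snd (c K)) < Min B" if "K \<subset> F" for K
        using aB(3) sub that by (subst (asm) Max_less_iff) auto
      then have "ok c F (a, B)" using aB unfolding ok_def by auto
      then show ?thesis by blast
    qed (simp add: ok_def)
  qed
  then obtain c where c: "\<And>F. ok c F (c F)" by blast
  show thesis
  proof (rule that[of c])
    show "\<forall>F\<in>Pf seqs. c F \<in> posnat \<times> Pf posnat"
      using c unfolding ok_def by blast
    show "\<forall>F\<in>Pf seqs. \<forall>G\<in>Pf seqs. F \<subset> G \<longrightarrow> Max (snd (c F)) < Min (snd (c G))"
      using c unfolding ok_def by blast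
    have "P xs" if "block_sums (choice_sum c) seqs K xs" "length xs = m" for K xs
      using iter[of xs] good[OF that(1) c] that(2) by simp
    then show "\<forall>K xs. block_sums (choice_sum c) seqs K xs \<and> length xs = m \<longrightarrow> P xs" by blast
  qed
qed

section \<open>From the selection of sums to an idempotent\<close>

text \<open>The constant maps suffice. Consequently every finite set of sequences has a proper
  finite extension, so chains can always be continued.\<close>

lemma infinite_seqs: "infinite seqs"
proof
  assume "finite seqs"
  moreover have "range (\<lambda>n. \<lambda>t\<in>posnat. Suc n) \<subseteq> seqs" by (auto split: if_splits)
  ultimately have "finite (range (\<lambda>n. \<lambda>t\<in>posnat. Suc n))" by (rule rev_finite_subset)
  moreover have "inj (\<lambda>n. \<lambda>t\<in>posnat. Suc n)"
    by (intro injI) (metis atLeast_iff le_refl nat.inject restrict_apply')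
  ultimately show False using finite_imageD by blast
qed

interpretation posnat: semigroup_carrier posnat "(+)"
  by unfold_locales auto

interpretation vectors: semigroup_carrier "{u :: 'a \<Rightarrow> nat. \<forall>i. u i \<in> posnat}" "\<lambda>u w i. u i + w i"
  by unfold_locales (auto simp: add.assoc intro: trans_le_add1)

lemma uf_add_eq_uf_mult: "uf_add p q = uf_mult posnat (+) p q"
  by (simp add: uf_add_def uf_mult_def shift_def)

text \<open>The data of (1) together with (a); condition (b) enters at the end, where block sums are
  placed in \<open>A\<close>.\<close>

locale selection =
  fixes \<alpha> :: "(nat \<Rightarrow> nat) set \<Rightarrow> nat" and H :: "(nat \<Rightarrow> nat) set \<Rightarrow> nat set"
  assumes \<alpha>: "\<alpha> \<in> Pf seqs \<rightarrow> posnat" and H: "H \<in> Pf seqs \<rightarrow> Pf posnat"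
    and H_less: "\<lbrakk>F \<in> Pf seqs; G \<in> Pf seqs; F \<subset> G\<rbrakk> \<Longrightarrow> Max (H F) < Min (H G)"
begin

definition val :: "(nat \<Rightarrow> nat) set \<Rightarrow> (nat \<Rightarrow> nat) \<Rightarrow> nat" where
  "val K f = \<alpha> K + (\<Sum>t\<in>H K. f t)"

definition sums_above :: "(nat \<Rightarrow> nat) set \<Rightarrow> nat set" where
  "sums_above F = {x. \<exists>K. chain_sum val seqs F K x}"

text \<open>Simultaneous chain sums, one for each \<open>f\<close>: at some links of the chain every coordinate
  uses its own function, at the others all coordinates use a common function.\<close>
inductive vector_sum :: "(nat \<Rightarrow> nat) set \<Rightarrow> (nat \<Rightarrow> nat) set \<Rightarrow> ((nat \<Rightarrow> nat) \<Rightarrow> nat) \<Rightarrow> bool" where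
  single: "\<lbrakk>F \<subset> K; K \<in> Pf seqs\<rbrakk> \<Longrightarrow> vector_sum F K (val K)"
| left: "\<lbrakk>chain_sum val seqs F L x; vector_sum L K u\<rbrakk> \<Longrightarrow> vector_sum F K (\<lambda>f. x + u f)"
| right: "\<lbrakk>vector_sum F L u; chain_sum val seqs L K x\<rbrakk> \<Longrightarrow> vector_sum F K (\<lambda>f. u f + x)"
| both: "\<lbrakk>vector_sum F L u; vector_sum L K w\<rbrakk> \<Longrightarrow> vector_sum F K (\<lambda>f. u f + w f)"

abbreviation vectors :: "((nat \<Rightarrow> nat) \<Rightarrow> nat) set" where
  "vectors \<equiv> {u. \<forall>f. u f \<in> posnat}"

definition vectors_above :: "(nat \<Rightarrow> nat) set \<Rightarrow> ((nat \<Rightarrow> nat) \<Rightarrow> nat) set" where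
  "vectors_above F = {u. \<exists>K. vector_sum F K u}"

text \<open>The empty set is included because the first entry of a tuple is chosen above
  \<open>{}\<close>.\<close>

abbreviation index :: "(nat \<Rightarrow> nat) set set" where
  "index \<equiv> {F. finite F \<and> F \<subseteq> seqs}"

lemma val_pos: "K \<in> Pf seqs \<Longrightarrow> 1 \<le> val K f"
  using funcset_mem[OF \<alpha>, of K] by (simp add: val_def)

lemma chain_sum_pos: "chain_sum val seqs F K x \<Longrightarrow> 1 \<le> x"
  by (induction rule: chain_sum.induct) (blast intro: val_pos trans_le_add1)+

lemma vector_sum_psubset: "vector_sum F K u \<Longrightarrow> F \<subset> K \<and> K \<in> Pf seqs"
  by (induction rule: vector_sum.induct) (blast dest: chain_sum_psubset)+

lemma vector_sum_pos: "vector_sum F K u \<Longrightarrow> 1 \<le> u f"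
  by (induction rule: vector_sum.induct) (simp_all only: val_pos trans_le_add1 trans_le_add2)

lemma vector_sum_mono: "\<lbrakk>vector_sum F K u; E \<subseteq> F\<rbrakk> \<Longrightarrow> vector_sum E K u"
  by (induction rule: vector_sum.induct) (blast intro: vector_sum.intros chain_sum_mono)+

text \<open>A function in \<open>F\<close> belongs to every later link, so coordinate
  \<open>f\<close> uses an admissible function wherever the coordinates differ.\<close>

lemma vector_sum_imp_chain_sum: "\<lbrakk>vector_sum F K u; f \<in> F\<rbrakk> \<Longrightarrow> chain_sum val seqs F K (u f)"
proof (induction rule: vector_sum.induct)
  case (single F K)
  then show ?case by (auto intro: chain_sum.single)
next
  case (left F L x K u)
  then show ?case using chain_sum_psubset by (metis chain_sum_trans psubsetD)
next
  case (right F L u K x)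
  then show ?case by (metis chain_sum_trans)
next
  case (both F L u K w)
  then show ?case using vector_sum_psubset by (metis chain_sum_trans psubsetD)
qed

lemma H_facts:
  assumes "K \<in> Pf seqs"
  shows "finite (H K)" "H K \<noteq> {}" "H K \<subseteq> posnat"
  using H assms by (auto simp: Pf_def Pi_iff)

lemma Max_H_less:
  assumes "F \<in> Pf seqs" "K \<in> Pf seqs" "F \<subset> K"
  shows "Max (H F) < Max (H K)"
  using H_less[OF assms] Min_le[OF H_facts(1)[OF assms(2)] Max_in[OF H_facts(1,2)[OF assms(2)]]]
  by linarith

text \<open>The disjointness of the sets \<open>H K\<close> along a chain makes the coordinates of a vector
  sum translates of \<open>\<Sum>t\<in>B. f t\<close> for one set \<open>B\<close>.\<close>
lemma vector_sum_form:
  assumes "vector_sum F K u" "F \<in> Pf seqs"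
  shows "\<exists>a\<in>posnat. \<exists>B\<in>Pf posnat. (\<forall>b\<in>B. Max (H F) < b \<and> b \<le> Max (H K)) \<and>
    (\<forall>f. u f = a + (\<Sum>t\<in>B. f t))"
  using assms
proof (induction rule: vector_sum.induct)
  case (single F K)
  have "Max (H F) < b \<and> b \<le> Max (H K)" if b: "b \<in> H K" for b
  proof -
    have "Max (H F) < Min (H K)" using single by (intro H_less)
    also have "Min (H K) \<le> b" using H_facts(1)[OF single.hyps(2)] b by simp
    finally show ?thesis using H_facts(1)[OF single.hyps(2)] b by simp
  qed
  moreover have "\<alpha> K \<in> posnat" "H K \<in> Pf posnat"
    using single.hyps(2) funcset_mem[OF \<alpha>] funcset_mem[OF H] by blast+
  ultimately show ?case unfolding val_def by blast
next
  case (left F L x K u)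
  have L: "F \<subset> L" "L \<in> Pf seqs" using chain_sum_psubset[OF left.hyps(1)] by auto
  with left obtain a B where aB: "a \<in> posnat" "B \<in> Pf posnat"
    "\<And>b. b \<in> B \<Longrightarrow> Max (H L) < b \<and> b \<le> Max (H K)" "\<And>f. u f = a + (\<Sum>t\<in>B. f t)"
    by blast
  \<comment> \<open>The common summand \<open>x\<close> is absorbed into the translate, and
    \<open>Max (H F) < Max (H L)\<close> preserves the lower bound on \<open>B\<close>.\<close>
  then show ?case
    using Max_H_less[OF left.prems L(2,1)]
    by (intro bexI[of _ "x + a"] bexI[of _ B]) (auto intro: less_trans)
next
  case (right F L u K x)
  have L: "L \<subset> K" "K \<in> Pf seqs" using chain_sum_psubset[OF right.hyps(2)] by auto
  have L': "L \<in> Pf seqs" using vector_sum_psubset[OF right.hyps(1)] by simp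
  from right obtain a B where aB: "a \<in> posnat" "B \<in> Pf posnat"
    "\<And>b. b \<in> B \<Longrightarrow> Max (H F) < b \<and> b \<le> Max (H L)" "\<And>f. u f = a + (\<Sum>t\<in>B. f t)"
    by blast
  then show ?case
    using Max_H_less[OF L' L(2,1)]
    by (intro bexI[of _ "a + x"] bexI[of _ B]) (auto intro: less_imp_le le_less_trans)
next
  case (both F L u K w)
  have L: "F \<subset> L" "L \<in> Pf seqs" using vector_sum_psubset[OF both.hyps(1)] by auto
  have K: "L \<subset> K" "K \<in> Pf seqs" using vector_sum_psubset[OF both.hyps(2)] by auto
  from both.IH(1)[OF both.prems] obtain a B where aB: "a \<in> posnat" "B \<in> Pf posnat"
    "\<And>b. b \<in> B \<Longrightarrow> Max (H F) < b \<and> b \<le> Max (H L)" "\<And>f. u f = a + (\<Sum>t\<in>B. f t)"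
    by blast
  from both.IH(2)[OF L(2)] obtain a' B' where aB': "a' \<in> posnat" "B' \<in> Pf posnat"
    "\<And>b. b \<in> B' \<Longrightarrow> Max (H L) < b \<and> b \<le> Max (H K)" "\<And>f. w f = a' + (\<Sum>t\<in>B'. f t)"
    by blast
  \<comment> \<open>The number \<open>Max (H L)\<close> separates the two sets.\<close>
  have "B \<inter> B' = {}" using aB(3) aB'(3) by fastforce
  then have "u f + w f = a + a' + (\<Sum>t\<in>B \<union> B'. f t)" for f
    using aB(2,4) aB'(2,4) by (simp add: Pf_def sum.union_disjoint)
  moreover have "Max (H F) < b \<and> b \<le> Max (H K)" if "b \<in> B \<union> B'" for b
    using that aB(3)[of b] aB'(3)[of b] Max_H_less[OF both.prems L(2,1)] Max_H_less[OF L(2) K(2,1)]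
    by auto
  moreover have "B \<union> B' \<in> Pf posnat" using aB(2) aB'(2) by (auto simp: Pf_def)
  moreover have "a + a' \<in> posnat" using aB(1) by simp
  ultimately show ?case by blast
qed

section \<open>Compact semigroups of ultrafilters on sums and on vectors\<close>

lemma index_extend:
  assumes "F \<in> index"
  obtains K where "F \<subset> K" "K \<in> Pf seqs"
proof -
  obtain g where "g \<in> seqs" "g \<notin> F"
    using assms infinite_seqs by (metis (mono_tags, lifting) finite_subset mem_Collect_eq subsetI)
  then show thesis using assms by (intro that[of "insert g F"]) (auto simp: Pf_def)
qed

lemma PfD: "K \<in> Pf seqs \<Longrightarrow> K \<in> index \<and> K \<noteq> {}"
  by (simp add: Pf_def)

lemma sums_aboveI: "chain_sum val seqs F K x \<Longrightarrow> x \<in> sums_above F"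
  by (auto simp only: sums_above_def)

lemma vectors_aboveI: "vector_sum F K u \<Longrightarrow> u \<in> vectors_above F"
  by (auto simp only: vectors_above_def)

lemma sums_above_subset: "sums_above F \<subseteq> posnat"
  by (auto simp: sums_above_def dest: chain_sum_pos[simplified])

lemma vectors_above_subset: "vectors_above F \<subseteq> vectors"
  by (auto simp: vectors_above_def dest: vector_sum_pos[simplified])

lemma sums_above_nonempty: "F \<in> index \<Longrightarrow> sums_above F \<noteq> {}"
proof -
  assume "F \<in> index"
  then obtain K where K: "F \<subset> K" "K \<in> Pf seqs" by (rule index_extend)
  then obtain f where "f \<in> K" using PfD by blast
  with K have "val K f \<in> sums_above F" by (blast intro: sums_aboveI chain_sum.single)
  then show ?thesis by blast
qed

lemma vectors_above_nonempty: "F \<in> index \<Longrightarrow> vectors_above F \<noteq> {}"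
proof -
  assume "F \<in> index"
  then obtain K where "F \<subset> K" "K \<in> Pf seqs" by (rule index_extend)
  then have "val K \<in> vectors_above F" by (blast intro: vectors_aboveI vector_sum.single)
  then show ?thesis by blast
qed

lemma sums_above_mono: "E \<subseteq> F \<Longrightarrow> sums_above F \<subseteq> sums_above E"
  using chain_sum_mono unfolding sums_above_def by blast

lemma vectors_above_mono: "E \<subseteq> F \<Longrightarrow> vectors_above F \<subseteq> vectors_above E"
  using vector_sum_mono unfolding vectors_above_def by blast

definition Q :: "nat set set set" where
  "Q = {p. ultrafilter_on posnat p \<and> (\<forall>F\<in>index. sums_above F \<in> p)}"

definition I :: "((nat \<Rightarrow> nat) \<Rightarrow> nat) set set set" where
  "I = {p. ultrafilter_on vectors p \<and> (\<forall>F\<in>index. vectors_above F \<in> p)}"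

text \<open>Nonemptiness comes from directedness of the sets \<open>sums_above F\<close>. For
  products, a sum above \<open>F\<close> with last link \<open>K\<close> may be followed by any sum
  above \<open>K\<close>.\<close>

lemma closed_subsemigroup_Q: "posnat.beta.closed_subsemigroup Q"
  unfolding posnat.beta.closed_subsemigroup_def
proof (intro conjI ballI)
  show "closedin (stone_topology posnat) Q"
    unfolding Q_def by (intro closedin_stone_basis sums_above_subset)
  show "Q \<noteq> {}"
  proof -
    obtain p where "ultrafilter_on posnat p" "\<forall>F\<in>index. sums_above F \<in> p"
    proof (rule ultrafilter_on_exists_directed[of index sums_above posnat])
      show "\<exists>G\<in>index. sums_above G \<subseteq> sums_above E \<inter> sums_above F" if "E \<in> index" "F \<in> index" for E F
        using that sums_above_mono by (intro bexI[of _ "E \<union> F"]) auto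
      show "sums_above F \<subseteq> posnat \<and> sums_above F \<noteq> {}" if "F \<in> index" for F
        using that by (intro conjI sums_above_subset sums_above_nonempty)
    qed (blast, rule that)
    then show ?thesis by (auto simp: Q_def)
  qed
  fix p q assume "p \<in> Q" "q \<in> Q"
  then have pq: "ultrafilter_on posnat p" "ultrafilter_on posnat q"
    "\<And>F. F \<in> index \<Longrightarrow> sums_above F \<in> p" "\<And>F. F \<in> index \<Longrightarrow> sums_above F \<in> q"
    by (auto simp: Q_def)
  have "sums_above F \<in> uf_mult posnat (+) p q" if "F \<in> index" for F
  proof (rule posnat.mem_uf_mult[OF pq(1,2) pq(3)[OF that] sums_above_subset])
    fix x assume "x \<in> sums_above F"
    then obtain K where K: "chain_sum val seqs F K x" by (auto simp: sums_above_def)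
    then have "K \<in> index" using chain_sum_psubset PfD by blast
    moreover have "x + y \<in> sums_above F" if "y \<in> sums_above K" for y
      using that K unfolding sums_above_def by (blast intro: chain_sum_trans)
    ultimately show "\<exists>D\<in>q. \<forall>y\<in>D. x + y \<in> sums_above F" using pq(4) by blast
  qed
  then show "uf_mult posnat (+) p q \<in> Q"
    using posnat.ultrafilter_on_uf_mult[OF pq(1,2)] by (simp add: Q_def)
qed

abbreviation vmult where
  "vmult \<equiv> uf_mult vectors (\<lambda>u w f. u f + w f)"

text \<open>The argument for \<open>Q\<close> carries over, with the rule \<open>both\<close> in
  place of concatenation of chains.\<close>

lemma closed_subsemigroup_I: "vectors.beta.closed_subsemigroup I"
  unfolding vectors.beta.closed_subsemigroup_def
proof (intro conjI ballI)
  show "closedin (stone_topology vectors) I"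
    unfolding I_def by (intro closedin_stone_basis vectors_above_subset)
  show "I \<noteq> {}"
  proof -
    obtain p where "ultrafilter_on vectors p" "\<forall>F\<in>index. vectors_above F \<in> p"
    proof (rule ultrafilter_on_exists_directed[of index vectors_above vectors])
      show "\<exists>G\<in>index. vectors_above G \<subseteq> vectors_above E \<inter> vectors_above F" if "E \<in> index" "F \<in> index" for E F
        using that vectors_above_mono by (intro bexI[of _ "E \<union> F"]) auto
      show "vectors_above F \<subseteq> vectors \<and> vectors_above F \<noteq> {}" if "F \<in> index" for F
        using that by (intro conjI vectors_above_subset vectors_above_nonempty)
    qed (blast, rule that)
    then show ?thesis by (auto simp: I_def)
  qed
  fix p q assume "p \<in> I" "q \<in> I"
  then have pq: "ultrafilter_on vectors p" "ultrafilter_on vectors q"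
    "\<And>F. F \<in> index \<Longrightarrow> vectors_above F \<in> p" "\<And>F. F \<in> index \<Longrightarrow> vectors_above F \<in> q"
    by (auto simp: I_def)
  have "vectors_above F \<in> vmult p q" if "F \<in> index" for F
  proof (rule vectors.mem_uf_mult[OF pq(1,2) pq(3)[OF that] vectors_above_subset])
    fix u assume "u \<in> vectors_above F"
    then obtain K where K: "vector_sum F K u" by (auto simp: vectors_above_def)
    then have "K \<in> index" using vector_sum_psubset PfD by blast
    moreover have "(\<lambda>f. u f + w f) \<in> vectors_above F" if "w \<in> vectors_above K" for w
      using that K unfolding vectors_above_def by (blast intro: vector_sum.both)
    ultimately show "\<exists>D\<in>q. \<forall>w\<in>D. (\<lambda>f. u f + w f) \<in> vectors_above F" using pq(4) by blast
  qed
  then show "vmult p q \<in> I"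
    using vectors.ultrafilter_on_uf_mult[OF pq(1,2)] by (simp add: I_def)
qed

section \<open>Diagonal ultrafilters and coordinate projections\<close>

abbreviation diag :: "nat set set \<Rightarrow> ((nat \<Rightarrow> nat) \<Rightarrow> nat) set set" where
  "diag \<equiv> uf_image posnat vectors (\<lambda>x _. x)"

text \<open>A diagonal vector adds one chain sum to all coordinates; the rules \<open>right\<close>
  and \<open>left\<close> of \<open>vector_sum\<close> are designed for exactly these two
  products.\<close>

lemma
  assumes p: "p \<in> Q" and q: "q \<in> I"
  shows mult_diag_mem_I: "vmult q (diag p) \<in> I" and diag_mult_mem_I: "vmult (diag p) q \<in> I"
proof -
  have p': "ultrafilter_on posnat p" "\<And>F. F \<in> index \<Longrightarrow> sums_above F \<in> p"
    and q': "ultrafilter_on vectors q" "\<And>F. F \<in> index \<Longrightarrow> vectors_above F \<in> q"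
    using assms by (auto simp: Q_def I_def)
  have dp: "ultrafilter_on vectors (diag p)" by (rule ultrafilter_on_uf_image[OF p'(1)]) simp
  have const: "(\<lambda>x _. x) ` sums_above F \<in> diag p" if "F \<in> index" for F
  proof -
    have "{x \<in> posnat. (\<lambda>_. x) \<in> (\<lambda>x (_ :: nat \<Rightarrow> nat). x) ` sums_above F} = sums_above F"
      using sums_above_subset[of F] by (auto simp: fun_eq_iff image_iff)
    then show ?thesis using p'(2)[OF that] sums_above_subset[of F] by (auto simp: uf_image_def)
  qed
  have "vectors_above F \<in> vmult q (diag p)" if "F \<in> index" for F
  proof (rule vectors.mem_uf_mult[OF q'(1) dp q'(2)[OF that] vectors_above_subset])
    fix u assume "u \<in> vectors_above F"
    then obtain K where K: "vector_sum F K u" by (auto simp: vectors_above_def)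
    then have "K \<in> index" using vector_sum_psubset PfD by blast
    moreover have "(\<lambda>f. u f + x) \<in> vectors_above F" if "x \<in> sums_above K" for x
      using that K unfolding vectors_above_def sums_above_def by (blast intro: vector_sum.right)
    ultimately show "\<exists>D\<in>diag p. \<forall>w\<in>D. (\<lambda>f. u f + w f) \<in> vectors_above F"
      by (intro bexI[OF _ const]) auto
  qed
  then show "vmult q (diag p) \<in> I"
    using vectors.ultrafilter_on_uf_mult[OF q'(1) dp] by (simp add: I_def)
  have "vectors_above F \<in> vmult (diag p) q" if "F \<in> index" for F
  proof (rule vectors.mem_uf_mult[OF dp q'(1) const[OF that] vectors_above_subset])
    fix w assume "w \<in> (\<lambda>x (_ :: nat \<Rightarrow> nat). x) ` sums_above F"
    then obtain x K where K: "chain_sum val seqs F K x" "w = (\<lambda>_. x)" by (auto simp: sums_above_def)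
    then have "K \<in> index" using chain_sum_psubset PfD by blast
    moreover have "(\<lambda>f. w f + u f) \<in> vectors_above F" if "u \<in> vectors_above K" for u
      using that K(1) unfolding K(2) vectors_above_def by (blast intro: vector_sum.left)
    ultimately show "\<exists>D\<in>q. \<forall>u\<in>D. (\<lambda>f. w f + u f) \<in> vectors_above F" using q'(2) by blast
  qed
  then show "vmult (diag p) q \<in> I"
    using vectors.ultrafilter_on_uf_mult[OF dp q'(1)] by (simp add: I_def)
qed

abbreviation proj :: "(nat \<Rightarrow> nat) \<Rightarrow> ((nat \<Rightarrow> nat) \<Rightarrow> nat) set set \<Rightarrow> nat set set" where
  "proj f \<equiv> uf_image vectors posnat (\<lambda>u. u f)"

lemma proj_diag: "ultrafilter_on posnat p \<Longrightarrow> proj f (diag p) = p"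
proof -
  assume p: "ultrafilter_on posnat p"
  have "{x \<in> posnat. (\<lambda>_. x) \<in> {u \<in> vectors. u f \<in> B}} = B" if "B \<subseteq> posnat" for B
    using that by auto
  then show ?thesis using ultrafilter_onD(1)[OF p] by (auto simp: uf_image_def)
qed

lemma proj_mult:
  "\<lbrakk>ultrafilter_on vectors p; ultrafilter_on vectors q\<rbrakk>
    \<Longrightarrow> proj f (vmult p q) = uf_mult posnat (+) (proj f p) (proj f q)"
  by (rule uf_image_uf_mult[OF vectors.semigroup_carrier_axioms posnat.semigroup_carrier_axioms]) auto

lemma diag_mult:
  "\<lbrakk>ultrafilter_on posnat p; ultrafilter_on posnat q\<rbrakk>
    \<Longrightarrow> diag (uf_mult posnat (+) p q) = vmult (diag p) (diag q)"
  by (rule uf_image_uf_mult[OF posnat.semigroup_carrier_axioms vectors.semigroup_carrier_axioms]) auto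

text \<open>Replacing \<open>F\<close> by \<open>insert f F\<close> brings \<open>f\<close> into the
  base set, where coordinate \<open>f\<close> of a vector sum is a chain sum.\<close>

lemma proj_mem_Q:
  assumes e: "e \<in> I" and f: "f \<in> seqs"
  shows "proj f e \<in> Q"
proof -
  have e': "ultrafilter_on vectors e" "\<And>F. F \<in> index \<Longrightarrow> vectors_above F \<in> e"
    using e by (auto simp: I_def)
  have "sums_above F \<in> proj f e" if F: "F \<in> index" for F
  proof -
    have in_sums: "u f \<in> sums_above F" if "u \<in> vectors_above (insert f F)" for u
    proof -
      from that obtain K where "vector_sum (insert f F) K u" unfolding vectors_above_def by blast
      then have "chain_sum val seqs (insert f F) K (u f)" by (rule vector_sum_imp_chain_sum) simp
      then have "u f \<in> sums_above (insert f F)" by (rule sums_aboveI)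
      then show ?thesis by (rule subsetD[OF sums_above_mono[OF subset_insertI]])
    qed
    have "vectors_above (insert f F) \<in> e" using F f by (intro e') auto
    moreover have "vectors_above (insert f F) \<subseteq> {u \<in> vectors. u f \<in> sums_above F}"
    proof
      fix u assume u: "u \<in> vectors_above (insert f F)"
      then have "u \<in> vectors" by (rule subsetD[OF vectors_above_subset])
      then show "u \<in> {u \<in> vectors. u f \<in> sums_above F}" using in_sums[OF u] by simp
    qed
    ultimately have "{u \<in> vectors. u f \<in> sums_above F} \<in> e"
      by (rule ultrafilter_onD(5)[OF e'(1)]) blast
    then show ?thesis using sums_above_subset by (simp add: uf_image_def)
  qed
  moreover have "ultrafilter_on posnat (proj f e)" by (rule ultrafilter_on_uf_image[OF e'(1)]) simp
  ultimately show ?thesis by (simp add: Q_def)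
qed

section \<open>A minimal idempotent whose members are J-sets\<close>

theorem J_idempotent_exists:
  obtains p where "p \<in> J_ufs" "idempotent_uf p" "\<forall>F\<in>index. sums_above F \<in> p"
proof -
  obtain p where p: "p \<in> Q" "uf_mult posnat (+) p p = p"
    and min: "\<forall>e\<in>Q. uf_mult posnat (+) e e = e \<and> uf_mult posnat (+) e p = e \<and>
      uf_mult posnat (+) p e = e \<longrightarrow> e = p"
    by (rule posnat.beta.minimal_idempotent[OF closed_subsemigroup_Q])
  have up: "ultrafilter_on posnat p" using p(1) by (simp add: Q_def)
  have udp: "ultrafilter_on vectors (diag p)" by (rule ultrafilter_on_uf_image[OF up]) simp
  obtain e where e: "e \<in> I" "vmult e e = e" "vmult e (diag p) = e" "vmult (diag p) e = e"
  proof (rule vectors.beta.idempotent_below[OF closed_subsemigroup_I])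
    show "diag p \<in> topspace (stone_topology vectors)" using udp by simp
    show "vmult (diag p) (diag p) = diag p" using diag_mult[OF up up] p(2) by simp
  qed (rule mult_diag_mem_I[OF p(1)] diag_mult_mem_I[OF p(1)], assumption)+
  have ue: "ultrafilter_on vectors e" using e(1) by (simp add: I_def)
  \<comment> \<open>Projection is a homomorphism that sends \<open>diag p\<close> back to
    \<open>p\<close>, so it turns the three equations for \<open>e\<close> into those saying that
    \<open>proj f e\<close> is an idempotent below \<open>p\<close>.\<close>
  have proj: "proj f e = p" if "f \<in> seqs" for f
  proof (rule min[rule_format]; (intro conjI)?)
    show "proj f e \<in> Q" by (rule proj_mem_Q[OF e(1) that])
    show "uf_mult posnat (+) (proj f e) (proj f e) = proj f e"
      using proj_mult[OF ue ue, of f] unfolding e(2) by simp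
    show "uf_mult posnat (+) (proj f e) p = proj f e"
      using proj_mult[OF ue udp, of f] unfolding e(3) proj_diag[OF up] by simp
    show "uf_mult posnat (+) p (proj f e) = proj f e"
      using proj_mult[OF udp ue, of f] unfolding e(4) proj_diag[OF up] by simp
  qed
  have "J_set A" if "A \<in> p" for A
    unfolding J_set_def
  proof (intro conjI ballI)
    show "A \<subseteq> posnat" using that ultrafilter_onD(1)[OF up] by simp
    fix F :: "(nat \<Rightarrow> nat) set" assume F: "F \<in> Pf seqs"
    \<comment> \<open>All projections being the same \<open>p\<close>, finitely many coordinates of
      one vector can be put into \<open>A\<close> together; a vector sum above \<open>F\<close>
      among these yields a common translate and index set.\<close>
    have "{u \<in> vectors. \<forall>f\<in>F. u \<in> {u \<in> vectors. u f \<in> A}} \<in> e"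
    proof (rule ultrafilter_on_Inter[OF ue])
      show "finite F" using F by (simp add: Pf_def)
      fix f assume "f \<in> F"
      then have "A \<in> proj f e" using proj[of f] F that by (auto simp: Pf_def)
      then show "{u \<in> vectors. u f \<in> A} \<in> e" by (simp add: uf_image_def)
    qed
    moreover have "vectors_above F \<in> e" using e(1) PfD[OF F] by (simp add: I_def)
    ultimately have "{u \<in> vectors. \<forall>f\<in>F. u \<in> {u \<in> vectors. u f \<in> A}} \<inter> vectors_above F \<in> e"
      by (rule ultrafilter_onD(4)[OF ue])
    then have "{u \<in> vectors. \<forall>f\<in>F. u \<in> {u \<in> vectors. u f \<in> A}} \<inter> vectors_above F \<noteq> {}"
      using ultrafilter_onD(3)[OF ue] by metis
    then obtain u K where u: "\<And>f. f \<in> F \<Longrightarrow> u f \<in> A" "vector_sum F K u"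
      by (auto simp: vectors_above_def)
    then show "\<exists>a\<in>posnat. \<exists>B\<in>Pf posnat. \<forall>f\<in>F. a + (\<Sum>t\<in>B. f t) \<in> A"
      using vector_sum_form[OF u(2) F] by metis
  qed
  then have "p \<in> J_ufs" using up by (simp add: J_ufs_def betaN_def)
  moreover have "idempotent_uf p" using p(2) by (simp add: idempotent_uf_def uf_add_eq_uf_mult)
  ultimately show thesis using that p(1) by (simp add: Q_def)
qed

text \<open>After a prefix with last link \<open>K\<close> every member of
  \<open>sums_above K\<close> is a permitted next entry. The last link moves with each entry, so
  \<open>K\<close> is generalized in the induction.\<close>

lemma iterated_uf_block_sums:
  assumes up: "ultrafilter_on posnat p" and p: "\<forall>F\<in>index. sums_above F \<in> p"
    and P: "\<And>K xs. \<lbrakk>block_sums val seqs K xs; length xs = m\<rbrakk> \<Longrightarrow> P xs"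
  shows "\<lbrakk>block_sums val seqs K xs; length xs + r = m\<rbrakk> \<Longrightarrow> iterated_uf p P r xs"
proof (induction r arbitrary: K xs)
  case (Suc r)
  have "sums_above K \<in> p" using block_sums_finite_subset[OF Suc.prems(1)] p by blast
  moreover have "sums_above K \<subseteq> {x \<in> posnat. iterated_uf p P r (xs @ [x])}"
  proof
    fix x assume x: "x \<in> sums_above K"
    then obtain L where "chain_sum val seqs K L x" by (auto simp: sums_above_def)
    then have "block_sums val seqs L (xs @ [x])"
      using block_sums_append_chain_sum Suc.prems(1) by blast
    then have "iterated_uf p P r (xs @ [x])" using Suc.IH Suc.prems(2) by simp
    then show "x \<in> {x \<in> posnat. iterated_uf p P r (xs @ [x])}" using x sums_above_subset by blast
  qed
  ultimately have "{x \<in> posnat. iterated_uf p P r (xs @ [x])} \<in> p"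
    by (rule ultrafilter_onD(5)[OF up]) blast
  then show ?case by simp
qed (simp add: P)

end

section \<open>The equivalence of the two statements\<close>

theorem theorem1p23:
  fixes m :: nat and A :: "nat list set"
  assumes "m \<ge> 1" and "A \<subseteq> tuples m"
  shows "(\<exists>(\<alpha> :: (nat \<Rightarrow> nat) set \<Rightarrow> nat) (H :: (nat \<Rightarrow> nat) set \<Rightarrow> nat set).
            \<alpha> \<in> Pf seqs \<rightarrow> posnat \<and> H \<in> Pf seqs \<rightarrow> Pf posnat \<and>
            (\<forall>F \<in> Pf seqs. \<forall>G \<in> Pf seqs. F \<subset> G \<longrightarrow> Max (H F) < Min (H G)) \<and>
            (\<forall>(n :: nat) (G :: nat \<Rightarrow> (nat \<Rightarrow> nat) set) (\<beta> :: nat \<Rightarrow> nat set) (f :: nat \<Rightarrow> nat \<Rightarrow> nat).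
               n \<ge> m \<and>
               (\<forall>i\<in>{1..n}. G i \<in> Pf seqs) \<and> (\<forall>i\<in>{1..<n}. G i \<subset> G (i + 1)) \<and>
               (\<forall>j\<in>{1..m}. \<beta> j \<in> Pf posnat) \<and> (\<forall>j\<in>{1..<m}. block_less (\<beta> j) (\<beta> (j + 1))) \<and>
               Max (\<beta> m) \<le> n \<and>
               (\<forall>i\<in>{1..n}. f i \<in> G i)
               \<longrightarrow> map (\<lambda>j. \<Sum>i\<in>\<beta> j. \<alpha> (G i) + (\<Sum>t\<in>H (G i). f i t)) [1..<m + 1] \<in> A))
         \<longleftrightarrow>
         (\<exists>p \<in> J_ufs. idempotent_uf p \<and> A \<in> tensor (\<lambda>i. p) m)"
    (is "(\<exists>\<alpha> H. _ \<alpha> H \<and> _ \<alpha> H \<and> _ \<alpha> H \<and> ?C \<alpha> H) \<longleftrightarrow> ?R" is "?L \<longleftrightarrow> _")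
proof
  obtain k where m: "m = Suc k" using assms(1) by (cases m) auto
  have tensor: "A \<in> tensor (\<lambda>i. p) m \<longleftrightarrow> iterated_uf p (\<lambda>xs. xs \<in> A) m []" for p
    using assms(2) unfolding m by (rule mem_tensor_power_iff)
  show ?R if ?L
  proof -
    from that obtain \<alpha> H where \<alpha>: "\<alpha> \<in> Pf seqs \<rightarrow> posnat" and H: "H \<in> Pf seqs \<rightarrow> Pf posnat"
      and H_less: "\<forall>F \<in> Pf seqs. \<forall>G \<in> Pf seqs. F \<subset> G \<longrightarrow> Max (H F) < Min (H G)"
      and C: "?C \<alpha> H"
      by (elim exE conjE) (rule that)
    interpret selection \<alpha> H using \<alpha> H H_less by unfold_locales auto
    obtain p where p: "p \<in> J_ufs" "idempotent_uf p"
      "\<forall>F\<in>index. sums_above F \<in> p"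
      by (rule J_idempotent_exists)
    have "xs \<in> A" if "block_sums val seqs K xs" and len: "length xs = m" for K xs
      using that(1)
    proof (rule blocks_of_block_sums)
      fix n G \<beta> f
      assume w: "length xs \<le> n"
        "\<And>i. i \<in> {1..n} \<Longrightarrow> G i \<in> Pf seqs \<and> f i \<in> G i" "\<And>i. i \<in> {1..<n} \<Longrightarrow> G i \<subset> G (i + 1)"
        "\<And>j. j \<in> {1..length xs} \<Longrightarrow> \<beta> j \<in> Pf posnat \<and> Max (\<beta> j) \<le> n"
        "\<And>j. j \<in> {1..<length xs} \<Longrightarrow> block_less (\<beta> j) (\<beta> (j + 1))"
        "xs = map (\<lambda>j. \<Sum>i\<in>\<beta> j. val (G i) (f i)) [1..<length xs + 1]"
      \<comment> \<open>The bound \<open>length xs \<le> n\<close> of the block witness is the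
        requirement \<open>n \<ge> m\<close> of (b).\<close>
      have "map (\<lambda>j. \<Sum>i\<in>\<beta> j. \<alpha> (G i) + (\<Sum>t\<in>H (G i). f i t)) [1..<m + 1] \<in> A"
        using w(1-5) assms(1) unfolding len
        by (intro C[THEN spec[of _ n], THEN spec[of _ G], THEN spec[of _ \<beta>], THEN spec[of _ f], THEN mp]
            conjI ballI) simp_all
      then show "xs \<in> A" using w(6) unfolding len by (simp add: val_def)
    qed
    moreover have "ultrafilter_on posnat p" using p(1) by (simp add: J_ufs_def betaN_def)
    ultimately have "iterated_uf p (\<lambda>xs. xs \<in> A) m []"
      using iterated_uf_block_sums[OF _ p(3) _ block_sums.empty] by simp
    then show ?thesis using p(1,2) tensor by blast
  qed
  show ?L if ?R
  proof -
    from that obtain p where p: "p \<in> J_ufs" "idempotent_uf p" "A \<in> tensor (\<lambda>i. p) m" by blast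
    have "iterated_uf p (\<lambda>xs. xs \<in> A) m []" using p(3) tensor by blast
    from idempotent_imp_selection[OF p(1,2) this]
    obtain c where c: "\<forall>F\<in>Pf seqs. c F \<in> posnat \<times> Pf posnat"
      "\<forall>F\<in>Pf seqs. \<forall>G\<in>Pf seqs. F \<subset> G \<longrightarrow> Max (snd (c F)) < Min (snd (c G))"
      "\<forall>K xs. block_sums (choice_sum c) seqs K xs \<and> length xs = m \<longrightarrow> xs \<in> A" .
    show ?thesis
    proof (intro exI[of _ "fst \<circ> c"] exI[of _ "snd \<circ> c"] conjI allI impI ballI; (elim conjE)?)
      show "fst \<circ> c \<in> Pf seqs \<rightarrow> posnat" "snd \<circ> c \<in> Pf seqs \<rightarrow> Pf posnat"
        using c(1) by (simp_all add: Pi_iff mem_Times_iff)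
      show "Max ((snd \<circ> c) F) < Min ((snd \<circ> c) G)" if "F \<in> Pf seqs" "G \<in> Pf seqs" "F \<subset> G" for F G
        using c(2) that by simp
      fix n :: nat and G :: "nat \<Rightarrow> (nat \<Rightarrow> nat) set" and \<beta> and f :: "nat \<Rightarrow> nat \<Rightarrow> nat"
      assume w: "\<forall>i\<in>{1..n}. G i \<in> Pf seqs" "\<forall>i\<in>{1..<n}. G i \<subset> G (i + 1)"
        "\<forall>j\<in>{1..m}. \<beta> j \<in> Pf posnat" "\<forall>j\<in>{1..<m}. block_less (\<beta> j) (\<beta> (j + 1))"
        "Max (\<beta> m) \<le> n" "\<forall>i\<in>{1..n}. f i \<in> G i"
      have "block_sums (choice_sum c) seqs (G (Max (\<beta> m)))
          (map (\<lambda>j. \<Sum>i\<in>\<beta> j. choice_sum c (G i) (f i)) [1..<m + 1])"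
        using w assms(1) by (intro block_sums_of_blocks) blast+
      then have "map (\<lambda>j. \<Sum>i\<in>\<beta> j. choice_sum c (G i) (f i)) [1..<m + 1] \<in> A"
        by (rule c(3)[THEN spec, THEN spec, THEN mp, OF conjI]) simp
      then show "map (\<lambda>j. \<Sum>i\<in>\<beta> j. (fst \<circ> c) (G i) + (\<Sum>t\<in>(snd \<circ> c) (G i). f i t)) [1..<m + 1] \<in> A"
        by simp
    qed
  qed
qed

end
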